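(* Let $R$ be a ring. The following conditions are equivalent: \begin{itemize} \item[(1)] $R$ is a semiregular ring and $J(R)=Z_r(R)$. \item[(2)] Every finitely generated projective right $R$-module is a CS-Rickart module which is also a $C_2$ module. \end{itemize}
   Context: All rings are associative with nonzero identity; modules are unitary right modules. $J(R)$ is the Jacobson radical and $Z_r(R)$ is the right singular ideal of $R$ (the set of elements whose right annihilator is an essential right ideal). $R$ is semiregular if $R/J(R)$ is von Neumann regular and idempotents lift modulo $J(R)$. A module $M$ is CS-Rickart if for every $\varphi\in\mathrm{End}_R(M)$, $\mathrm{Ker}\,\varphi$ is an essential submodule of a direct summand of $M$. A module $M$ is a $C_2$ module if every submodule of $M$ that is isomorphic to a direct summand of $M$ is itself a direct summand of $M$. *)

theory Defs
  imports "HOL-Algebra.Module" "HOL-Algebra.QuotRing"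
begin

section \<open>Right modules over a noncommutative ring\<close>

text \<open>
  The locale \<open>module\<close> of the library requires a commutative ring, so right modules over an arbitrary
  ring are introduced here on top of the library's record type for modules.  The scalar stands on
  the left in that record: \<open>a \<odot>\<^bsub>M\<^esub> x\<close> denotes the right action \<open>x a\<close>, which is why
  \<open>smult_assoc\<close> reverses the factors.  The fields \<open>mult\<close> and \<open>one\<close> of the record \<open>M\<close> play no role.
  The library's \<open>submodule H R M\<close> (additive subgroup closed under scalars) makes no commutativity
  assumption and is used as is.
\<close>

locale right_module = R?: ring R + M?: abelian_group M
  for R :: "('a, 'b) ring_scheme" (structure) and M :: "('a, 'm, 'c) module_scheme" (structure) +
  assumes smult_closed [simp, intro]:
      "\<lbrakk>a \<in> carrier R; x \<in> carrier M\<rbrakk> \<Longrightarrow> a \<odot>\<^bsub>M\<^esub> x \<in> carrier M"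
    and smult_l_distr:
      "\<lbrakk>a \<in> carrier R; b \<in> carrier R; x \<in> carrier M\<rbrakk> \<Longrightarrow>
        (a \<oplus>\<^bsub>R\<^esub> b) \<odot>\<^bsub>M\<^esub> x = a \<odot>\<^bsub>M\<^esub> x \<oplus>\<^bsub>M\<^esub> b \<odot>\<^bsub>M\<^esub> x"
    and smult_r_distr:
      "\<lbrakk>a \<in> carrier R; x \<in> carrier M; y \<in> carrier M\<rbrakk> \<Longrightarrow>
        a \<odot>\<^bsub>M\<^esub> (x \<oplus>\<^bsub>M\<^esub> y) = a \<odot>\<^bsub>M\<^esub> x \<oplus>\<^bsub>M\<^esub> a \<odot>\<^bsub>M\<^esub> y"
    and smult_assoc:
      "\<lbrakk>a \<in> carrier R; b \<in> carrier R; x \<in> carrier M\<rbrakk> \<Longrightarrow>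
        (a \<otimes>\<^bsub>R\<^esub> b) \<odot>\<^bsub>M\<^esub> x = b \<odot>\<^bsub>M\<^esub> (a \<odot>\<^bsub>M\<^esub> x)"
    and smult_one [simp]:
      "x \<in> carrier M \<Longrightarrow> \<one>\<^bsub>R\<^esub> \<odot>\<^bsub>M\<^esub> x = x"

definition rmod_hom ::
  "('a, 'b) ring_scheme \<Rightarrow> ('a, 'm) module \<Rightarrow> ('a, 'n) module \<Rightarrow> ('m \<Rightarrow> 'n) set"
  where "rmod_hom R M N =
    {f \<in> carrier M \<rightarrow> carrier N.
       (\<forall>x\<in>carrier M. \<forall>y\<in>carrier M. f (x \<oplus>\<^bsub>M\<^esub> y) = f x \<oplus>\<^bsub>N\<^esub> f y) \<and>
       (\<forall>a\<in>carrier R. \<forall>x\<in>carrier M. f (a \<odot>\<^bsub>M\<^esub> x) = a \<odot>\<^bsub>N\<^esub> f x)}"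

definition rmod_iso ::
  "('a, 'b) ring_scheme \<Rightarrow> ('a, 'm) module \<Rightarrow> ('a, 'n) module \<Rightarrow> bool"
  where "rmod_iso R M N \<longleftrightarrow> (\<exists>f \<in> rmod_hom R M N. bij_betw f (carrier M) (carrier N))"

definition direct_summand ::
  "'m set \<Rightarrow> ('a, 'b) ring_scheme \<Rightarrow> ('a, 'm) module \<Rightarrow> bool"
  where "direct_summand A R M \<longleftrightarrow> submodule A R M \<and>
    (\<exists>B. submodule B R M \<and> A \<inter> B = {\<zero>\<^bsub>M\<^esub>} \<and> A <+>\<^bsub>M\<^esub> B = carrier M)"

text \<open>\<open>N\<close> is an essential submodule of the submodule \<open>K\<close> of \<open>M\<close>.\<close>

definition essential_in ::
  "'m set \<Rightarrow> 'm set \<Rightarrow> ('a, 'b) ring_scheme \<Rightarrow> ('a, 'm) module \<Rightarrow> bool"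
  where "essential_in N K R M \<longleftrightarrow>
    submodule N R M \<and> submodule K R M \<and> N \<subseteq> K \<and>
    (\<forall>L. submodule L R M \<and> L \<subseteq> K \<and> L \<noteq> {\<zero>\<^bsub>M\<^esub>} \<longrightarrow> N \<inter> L \<noteq> {\<zero>\<^bsub>M\<^esub>})"

definition CS_Rickart :: "('a, 'b) ring_scheme \<Rightarrow> ('a, 'm) module \<Rightarrow> bool"
  where "CS_Rickart R M \<longleftrightarrow>
    (\<forall>f \<in> rmod_hom R M M. \<exists>D. direct_summand D R M \<and> essential_in (a_kernel M M f) D R M)"

definition C2_module :: "('a, 'b) ring_scheme \<Rightarrow> ('a, 'm) module \<Rightarrow> bool"
  where "C2_module R M \<longleftrightarrow>
    (\<forall>N A. submodule N R M \<and> direct_summand A R M \<and>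
       rmod_iso R (M\<lparr>carrier := N\<rparr>) (M\<lparr>carrier := A\<rparr>) \<longrightarrow> direct_summand N R M)"

definition finitely_generated :: "('a, 'b) ring_scheme \<Rightarrow> ('a, 'm) module \<Rightarrow> bool"
  where "finitely_generated R M \<longleftrightarrow>
    (\<exists>S. finite S \<and> S \<subseteq> carrier M \<and> (\<forall>N. submodule N R M \<and> S \<subseteq> N \<longrightarrow> N = carrier M))"

text \<open>The free right module \<open>R\<^sup>(\<^sup>I\<^sup>)\<close>: families in \<open>R\<close> with finite support contained in \<open>I\<close>.\<close>

definition free_right_module :: "('a, 'b) ring_scheme \<Rightarrow> 'x set \<Rightarrow> ('a, 'x \<Rightarrow> 'a) module"
  where "free_right_module R I =
    \<lparr>carrier = {f. range f \<subseteq> carrier R \<and> {x. f x \<noteq> \<zero>\<^bsub>R\<^esub>} \<subseteq> I \<and> finite {x. f x \<noteq> \<zero>\<^bsub>R\<^esub>}},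
     monoid.mult = undefined, one = undefined,
     zero = (\<lambda>_. \<zero>\<^bsub>R\<^esub>), add = (\<lambda>f g x. f x \<oplus>\<^bsub>R\<^esub> g x),
     smult = (\<lambda>a f x. f x \<otimes>\<^bsub>R\<^esub> a)\<rparr>"

text \<open>
  Projective: isomorphic to a direct summand of a free module.  Index sets \<open>I\<close> over the element type
  of \<open>M\<close> suffice: a direct summand of any free module is a direct summand of the free module on its
  own underlying set, because the canonical surjection from the latter splits.
\<close>

definition projective :: "('a, 'b) ring_scheme \<Rightarrow> ('a, 'm) module \<Rightarrow> bool"
  where "projective R M \<longleftrightarrow>
    (\<exists>(I :: 'm set) D. direct_summand D R (free_right_module R I) \<and>
       rmod_iso R M ((free_right_module R I)\<lparr>carrier := D\<rparr>))"

text \<open>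
  A quantifier over all finitely generated projective modules ranges, up to isomorphism, over those
  with elements in \<open>nat \<Rightarrow> 'a\<close>: each is isomorphic to a direct summand of some \<open>R\<^sup>n\<close>.  The theorem
  quantifies over this element type in the equivalence, and states the consequences of the ring
  condition for modules over an arbitrary element type as well.
\<close>


section \<open>Ring-theoretic notions\<close>

text \<open>The ring as a right module over itself; its submodules are the right ideals.\<close>

definition right_regular_module :: "('a, 'b) ring_scheme \<Rightarrow> ('a, 'a) module"
  where "right_regular_module R =
    \<lparr>carrier = carrier R, monoid.mult = monoid.mult R, one = one R, zero = zero R, add = add R,
     smult = (\<lambda>a x. x \<otimes>\<^bsub>R\<^esub> a)\<rparr>"

abbreviation right_ideal :: "'a set \<Rightarrow> ('a, 'b) ring_scheme \<Rightarrow> bool"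
  where "right_ideal I R \<equiv> submodule I R (right_regular_module R)"

definition maximal_right_ideal :: "'a set \<Rightarrow> ('a, 'b) ring_scheme \<Rightarrow> bool"
  where "maximal_right_ideal I R \<longleftrightarrow> right_ideal I R \<and> I \<noteq> carrier R \<and>
    (\<forall>K. right_ideal K R \<and> I \<subseteq> K \<longrightarrow> K = I \<or> K = carrier R)"

definition jacobson_radical :: "('a, 'b) ring_scheme \<Rightarrow> 'a set"
  where "jacobson_radical R = {x \<in> carrier R. \<forall>I. maximal_right_ideal I R \<longrightarrow> x \<in> I}"

definition right_annihilator :: "('a, 'b) ring_scheme \<Rightarrow> 'a \<Rightarrow> 'a set"
  where "right_annihilator R x = {r \<in> carrier R. x \<otimes>\<^bsub>R\<^esub> r = \<zero>\<^bsub>R\<^esub>}"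

definition right_singular_ideal :: "('a, 'b) ring_scheme \<Rightarrow> 'a set"
  where "right_singular_ideal R =
    {x \<in> carrier R. essential_in (right_annihilator R x) (carrier R) R (right_regular_module R)}"

definition von_neumann_regular :: "('a, 'b) ring_scheme \<Rightarrow> bool"
  where "von_neumann_regular R \<longleftrightarrow>
    (\<forall>a\<in>carrier R. \<exists>b\<in>carrier R. a \<otimes>\<^bsub>R\<^esub> b \<otimes>\<^bsub>R\<^esub> a = a)"

definition idempotents_lift_modulo :: "'a set \<Rightarrow> ('a, 'b) ring_scheme \<Rightarrow> bool"
  where "idempotents_lift_modulo I R \<longleftrightarrow>
    (\<forall>x\<in>carrier R. x \<otimes>\<^bsub>R\<^esub> x \<ominus>\<^bsub>R\<^esub> x \<in> I \<longrightarrow>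
       (\<exists>e\<in>carrier R. e \<otimes>\<^bsub>R\<^esub> e = e \<and> e \<ominus>\<^bsub>R\<^esub> x \<in> I))"

definition semiregular :: "('a, 'b) ring_scheme \<Rightarrow> bool"
  where "semiregular R \<longleftrightarrow>
    von_neumann_regular (R Quot (jacobson_radical R)) \<and>
    idempotents_lift_modulo (jacobson_radical R) R"

end

theory Submission
  imports Defs
begin

text \<open>
  Both conditions of the theorem say that maps are regular up to something negligible, and they are
  compared through two intermediate conditions that make this precise.

  For a module \<open>M\<close>, being CS-Rickart and \<open>C\<^sub>2\<close> together means that every endomorphism \<open>\<phi>\<close> has a
  quasi-inverse \<open>\<psi>\<close>: \<open>\<psi>\<phi>\<psi> = \<psi>\<close>, and the kernel of \<open>\<phi> - \<phi>\<psi>\<phi>\<close> is essential in \<open>M\<close>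
  (\<open>regular_up_to_essential_kernel\<close>).  In one direction, the kernel of
  \<open>\<psi>\<phi>\<close> is the summand that contains the kernel of \<open>\<phi>\<close> as an essential submodule; in the
  other, \<open>\<psi>\<close> inverts \<open>\<phi>\<close> on a complement of such a summand, the \<open>C\<^sub>2\<close> condition
  providing the projection onto the image of that complement.

  For the right module \<open>R\<close> this reads: every \<open>a\<close> has a \<open>b\<close> with \<open>bab = b\<close> and \<open>a - aba\<close> in the right
  singular ideal (\<open>regular_modulo_singular\<close>).  For a ring this is equivalent to semiregularity
  together with the equality of the radical and the right singular ideal.  Such a ring is regular
  modulo its singular ideal, idempotents lift along \<open>bab = b\<close>, and \<open>1 - z\<close> is a unit for singular
  \<open>z\<close>, which gives both inclusions between the two ideals.  Conversely, lifted idempotents make it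
  possible to turn an inverse modulo the radical into a quasi-inverse \<open>b\<close> with \<open>bab = b\<close>.

  The free module of rank one therefore suffices for the implication from modules to the ring.  For
  the reverse implication the condition has to be carried from \<open>R\<close> to a finitely generated
  projective module.  Matrices are avoided by working with a finite dual basis and eliminating one
  coordinate after the other, first for maps \<open>R \<rightarrow> M\<close> (\<open>functional_quasi_inverse\<close>), then for
  maps \<open>M \<rightarrow> M\<close> (\<open>quasi_inverse_on_finite_set\<close>).  Finally, an endomorphism with
  singular values on the finitely many generators has essential kernel.
\<close>

section \<open>Right modules and their homomorphisms\<close>

text \<open>
  The method \<open>algebra\<close> normalises sums of ring elements; this makes it available for the
  additive group of a module.
\<close>

lemmas (in abelian_group) abelian_group_normal_form
  [algebra abelian_group "zero G" "add G" "a_inv G" "a_minus G"] =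
  a_closed zero_closed a_inv_closed minus_closed a_assoc l_zero l_neg a_comm minus_eq
  r_zero r_neg r_neg2 r_neg1 minus_add minus_minus a_lcomm

context right_module
begin

lemma smult_l_null [simp]: "x \<in> carrier M \<Longrightarrow> \<zero>\<^bsub>R\<^esub> \<odot>\<^bsub>M\<^esub> x = \<zero>\<^bsub>M\<^esub>"
  using smult_l_distr [of "\<zero>\<^bsub>R\<^esub>" "\<zero>\<^bsub>R\<^esub>" x] M.add.l_cancel_one' [of "\<zero>\<^bsub>R\<^esub> \<odot>\<^bsub>M\<^esub> x" "\<zero>\<^bsub>R\<^esub> \<odot>\<^bsub>M\<^esub> x"]
  by simp

lemma smult_r_null [simp]: "a \<in> carrier R \<Longrightarrow> a \<odot>\<^bsub>M\<^esub> \<zero>\<^bsub>M\<^esub> = \<zero>\<^bsub>M\<^esub>"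
  using smult_r_distr [of a "\<zero>\<^bsub>M\<^esub>" "\<zero>\<^bsub>M\<^esub>"] M.add.l_cancel_one' [of "a \<odot>\<^bsub>M\<^esub> \<zero>\<^bsub>M\<^esub>" "a \<odot>\<^bsub>M\<^esub> \<zero>\<^bsub>M\<^esub>"]
  by simp

lemma smult_l_minus:
  "a \<in> carrier R \<Longrightarrow> x \<in> carrier M \<Longrightarrow> (\<ominus>\<^bsub>R\<^esub> a) \<odot>\<^bsub>M\<^esub> x = \<ominus>\<^bsub>M\<^esub> (a \<odot>\<^bsub>M\<^esub> x)"
  using smult_l_distr [of "\<ominus>\<^bsub>R\<^esub> a" a x]
  by (intro M.minus_equality [symmetric]) (simp_all add: R.l_neg)

lemma smult_r_minus:
  "a \<in> carrier R \<Longrightarrow> x \<in> carrier M \<Longrightarrow> a \<odot>\<^bsub>M\<^esub> (\<ominus>\<^bsub>M\<^esub> x) = \<ominus>\<^bsub>M\<^esub> (a \<odot>\<^bsub>M\<^esub> x)"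
  using smult_r_distr [of a "\<ominus>\<^bsub>M\<^esub> x" x]
  by (intro M.minus_equality [symmetric]) (simp_all add: M.l_neg)

lemma smult_r_diff:
  "a \<in> carrier R \<Longrightarrow> x \<in> carrier M \<Longrightarrow> y \<in> carrier M \<Longrightarrow>
    a \<odot>\<^bsub>M\<^esub> (x \<ominus>\<^bsub>M\<^esub> y) = a \<odot>\<^bsub>M\<^esub> x \<ominus>\<^bsub>M\<^esub> a \<odot>\<^bsub>M\<^esub> y"
  by (simp add: M.minus_eq smult_r_distr smult_r_minus)

lemma diff_eq_zero_iff:
  "x \<in> carrier M \<Longrightarrow> y \<in> carrier M \<Longrightarrow> x \<ominus>\<^bsub>M\<^esub> y = \<zero>\<^bsub>M\<^esub> \<longleftrightarrow> x = y"
  by (metis M.add.inv_closed M.add.inv_solve_right M.l_zero M.minus_eq M.r_neg M.zero_closed)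

lemma diff_zero [simp]: "x \<in> carrier M \<Longrightarrow> x \<ominus>\<^bsub>M\<^esub> \<zero>\<^bsub>M\<^esub> = x"
  by (metis M.minus_equality M.minus_eq M.r_zero M.zero_closed)

text \<open>
  Negation is multiplication by the scalar \<open>-1\<close>, so closure under scalars covers it.
\<close>

lemma submodule_iff:
  "submodule H R M \<longleftrightarrow> H \<subseteq> carrier M \<and> \<zero>\<^bsub>M\<^esub> \<in> H \<and>
    (\<forall>x\<in>H. \<forall>y\<in>H. x \<oplus>\<^bsub>M\<^esub> y \<in> H) \<and> (\<forall>a\<in>carrier R. \<forall>x\<in>H. a \<odot>\<^bsub>M\<^esub> x \<in> H)"
proof
  assume "submodule H R M"
  then interpret H: submodule H R M .
  show "H \<subseteq> carrier M \<and> \<zero>\<^bsub>M\<^esub> \<in> H \<and>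
    (\<forall>x\<in>H. \<forall>y\<in>H. x \<oplus>\<^bsub>M\<^esub> y \<in> H) \<and> (\<forall>a\<in>carrier R. \<forall>x\<in>H. a \<odot>\<^bsub>M\<^esub> x \<in> H)"
    using H.subset H.m_closed H.one_closed by simp
next
  assume H: "H \<subseteq> carrier M \<and> \<zero>\<^bsub>M\<^esub> \<in> H \<and>
    (\<forall>x\<in>H. \<forall>y\<in>H. x \<oplus>\<^bsub>M\<^esub> y \<in> H) \<and> (\<forall>a\<in>carrier R. \<forall>x\<in>H. a \<odot>\<^bsub>M\<^esub> x \<in> H)"
  have "\<ominus>\<^bsub>M\<^esub> x \<in> H" if "x \<in> H" for x
  proof -
    have "(\<ominus>\<^bsub>R\<^esub> \<one>\<^bsub>R\<^esub>) \<odot>\<^bsub>M\<^esub> x = \<ominus>\<^bsub>M\<^esub> x"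
      using H that by (subst smult_l_minus) auto
    then show ?thesis
      using H that by (metis R.add.inv_closed R.one_closed)
  qed
  then show "submodule H R M"
    using H by (auto intro!: submodule.intro subgroup.intro simp: submodule_axioms_def a_inv_def)
qed

lemma submoduleD:
  assumes "submodule H R M"
  shows "H \<subseteq> carrier M" "\<zero>\<^bsub>M\<^esub> \<in> H" "\<And>x. x \<in> H \<Longrightarrow> x \<in> carrier M"
    "\<And>x y. x \<in> H \<Longrightarrow> y \<in> H \<Longrightarrow> x \<oplus>\<^bsub>M\<^esub> y \<in> H"
    "\<And>a x. a \<in> carrier R \<Longrightarrow> x \<in> H \<Longrightarrow> a \<odot>\<^bsub>M\<^esub> x \<in> H"
  using assms unfolding submodule_iff by auto

lemma submodule_right_module:
  assumes H: "submodule H R M"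
  shows "right_module R (M\<lparr>carrier := H\<rparr>)"
proof (intro right_module.intro abelian_groupI right_module_axioms.intro)
  show "ring R" ..
  fix x assume "x \<in> carrier (M\<lparr>carrier := H\<rparr>)"
  then have x: "x \<in> H" "x \<in> carrier M" using submoduleD(1)[OF H] by auto
  show "\<exists>y\<in>carrier (M\<lparr>carrier := H\<rparr>). y \<oplus>\<^bsub>M\<lparr>carrier := H\<rparr>\<^esub> x = \<zero>\<^bsub>M\<lparr>carrier := H\<rparr>\<^esub>"
    using x submoduleD(5)[OF H, of "\<ominus>\<^bsub>R\<^esub> \<one>\<^bsub>R\<^esub>" x]
    by (auto simp: smult_l_minus M.l_neg intro!: bexI[of _ "\<ominus>\<^bsub>M\<^esub> x"])
qed (use submoduleD[OF H] in \<open>auto simp: smult_l_distr smult_r_distr smult_assoc subset_iff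
      M.a_assoc intro: M.a_comm\<close>)

lemma cyclic_submodule:
  assumes "x \<in> carrier M"
  shows "submodule {a \<odot>\<^bsub>M\<^esub> x | a. a \<in> carrier R} R M"
  unfolding submodule_iff
proof (intro conjI ballI subsetI)
  show "\<zero>\<^bsub>M\<^esub> \<in> {a \<odot>\<^bsub>M\<^esub> x |a. a \<in> carrier R}"
    using assms by (auto intro!: exI[of _ "\<zero>\<^bsub>R\<^esub>"])
next
  fix y z assume "y \<in> {a \<odot>\<^bsub>M\<^esub> x |a. a \<in> carrier R}" "z \<in> {a \<odot>\<^bsub>M\<^esub> x |a. a \<in> carrier R}"
  then obtain a b where "y = a \<odot>\<^bsub>M\<^esub> x" "z = b \<odot>\<^bsub>M\<^esub> x" "a \<in> carrier R" "b \<in> carrier R" by auto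
  then show "y \<oplus>\<^bsub>M\<^esub> z \<in> {a \<odot>\<^bsub>M\<^esub> x |a. a \<in> carrier R}"
    using assms by (auto intro!: exI[of _ "a \<oplus>\<^bsub>R\<^esub> b"] simp: smult_l_distr)
next
  fix b y assume "b \<in> carrier R" "y \<in> {a \<odot>\<^bsub>M\<^esub> x |a. a \<in> carrier R}"
  then obtain a where "y = a \<odot>\<^bsub>M\<^esub> x" "a \<in> carrier R" "b \<in> carrier R" by auto
  then show "b \<odot>\<^bsub>M\<^esub> y \<in> {a \<odot>\<^bsub>M\<^esub> x |a. a \<in> carrier R}"
    using assms by (auto intro!: exI[of _ "a \<otimes>\<^bsub>R\<^esub> b"] simp: smult_assoc)
qed (use assms in auto)

end

text \<open>
  Essentiality only has to be tested on the cyclic submodules \<open>xR\<close>.  In the elementwise form no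
  submodule is quantified over, and finitely many tests can be carried out one after the other by
  multiplying the scalars found.
\<close>

lemma essential_in_iff:
  assumes M: "right_module R M"
    and NK: "submodule N R M" "submodule K R M" "N \<subseteq> K"
  shows "essential_in N K R M \<longleftrightarrow>
    (\<forall>x\<in>K. x \<noteq> \<zero>\<^bsub>M\<^esub> \<longrightarrow> (\<exists>r\<in>carrier R. r \<odot>\<^bsub>M\<^esub> x \<noteq> \<zero>\<^bsub>M\<^esub> \<and> r \<odot>\<^bsub>M\<^esub> x \<in> N))"
    (is "_ \<longleftrightarrow> ?elementwise")
proof -
  interpret right_module R M by fact
  show ?thesis
  proof
    assume ess: "essential_in N K R M"
    show ?elementwise
    proof (intro ballI impI)
      fix x assume x: "x \<in> K" "x \<noteq> \<zero>\<^bsub>M\<^esub>"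
      let ?L = "{a \<odot>\<^bsub>M\<^esub> x | a. a \<in> carrier R}"
      have xM: "x \<in> carrier M" using x submoduleD(1)[OF NK(2)] by auto
      have "x \<in> ?L" using xM by (auto intro!: exI[of _ "\<one>\<^bsub>R\<^esub>"])
      moreover have "?L \<subseteq> K" using x submoduleD(5)[OF NK(2)] by auto
      ultimately have "N \<inter> ?L \<noteq> {\<zero>\<^bsub>M\<^esub>}"
        using ess cyclic_submodule[OF xM] x unfolding essential_in_def by blast
      moreover have "\<zero>\<^bsub>M\<^esub> \<in> N \<inter> ?L"
        using submoduleD(2)[OF NK(1)] submoduleD(2)[OF cyclic_submodule[OF xM]] by auto
      ultimately show "\<exists>r\<in>carrier R. r \<odot>\<^bsub>M\<^esub> x \<noteq> \<zero>\<^bsub>M\<^esub> \<and> r \<odot>\<^bsub>M\<^esub> x \<in> N" by blast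
    qed
  next
    assume el: ?elementwise
    have "N \<inter> L \<noteq> {\<zero>\<^bsub>M\<^esub>}" if L: "submodule L R M" "L \<subseteq> K" "L \<noteq> {\<zero>\<^bsub>M\<^esub>}" for L
    proof -
      obtain x where x: "x \<in> L" "x \<noteq> \<zero>\<^bsub>M\<^esub>" using L submoduleD(2)[OF L(1)] by auto
      then obtain r where "r \<in> carrier R" "r \<odot>\<^bsub>M\<^esub> x \<noteq> \<zero>\<^bsub>M\<^esub>" "r \<odot>\<^bsub>M\<^esub> x \<in> N"
        using el L(2) by blast
      then show ?thesis using submoduleD(5)[OF L(1)] x by blast
    qed
    then show "essential_in N K R M" using NK unfolding essential_in_def by blast
  qed
qed

lemma rmod_homI:
  assumes "\<And>x. x \<in> carrier M \<Longrightarrow> f x \<in> carrier N"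
    "\<And>x y. x \<in> carrier M \<Longrightarrow> y \<in> carrier M \<Longrightarrow> f (x \<oplus>\<^bsub>M\<^esub> y) = f x \<oplus>\<^bsub>N\<^esub> f y"
    "\<And>a x. a \<in> carrier R \<Longrightarrow> x \<in> carrier M \<Longrightarrow> f (a \<odot>\<^bsub>M\<^esub> x) = a \<odot>\<^bsub>N\<^esub> f x"
  shows "f \<in> rmod_hom R M N"
  using assms unfolding rmod_hom_def by auto

lemma rmod_homD:
  assumes "f \<in> rmod_hom R M N"
  shows "\<And>x. x \<in> carrier M \<Longrightarrow> f x \<in> carrier N"
    "\<And>x y. x \<in> carrier M \<Longrightarrow> y \<in> carrier M \<Longrightarrow> f (x \<oplus>\<^bsub>M\<^esub> y) = f x \<oplus>\<^bsub>N\<^esub> f y"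
    "\<And>a x. a \<in> carrier R \<Longrightarrow> x \<in> carrier M \<Longrightarrow> f (a \<odot>\<^bsub>M\<^esub> x) = a \<odot>\<^bsub>N\<^esub> f x"
  using assms unfolding rmod_hom_def by auto

lemma rmod_hom_zero:
  assumes "right_module R M" "right_module R N" "f \<in> rmod_hom R M N"
  shows "f \<zero>\<^bsub>M\<^esub> = \<zero>\<^bsub>N\<^esub>"
proof -
  interpret M: right_module R M by fact
  interpret N: right_module R N by fact
  show ?thesis
    using rmod_homD(3)[OF assms(3), of "\<zero>\<^bsub>R\<^esub>" "\<zero>\<^bsub>M\<^esub>"] rmod_homD(1)[OF assms(3), of "\<zero>\<^bsub>M\<^esub>"] by simp
qed

lemma rmod_hom_diff:
  assumes "right_module R M" "right_module R N" "f \<in> rmod_hom R M N"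
    "x \<in> carrier M" "y \<in> carrier M"
  shows "f (x \<ominus>\<^bsub>M\<^esub> y) = f x \<ominus>\<^bsub>N\<^esub> f y"
proof -
  interpret M: right_module R M by fact
  interpret N: right_module R N by fact
  have "f (\<ominus>\<^bsub>M\<^esub> y) = \<ominus>\<^bsub>N\<^esub> f y"
    using rmod_homD(3)[OF assms(3), of "\<ominus>\<^bsub>R\<^esub> \<one>\<^bsub>R\<^esub>" y] rmod_homD(1)[OF assms(3)] assms(5)
    by (simp add: M.smult_l_minus N.smult_l_minus)
  then show ?thesis
    using assms rmod_homD[OF assms(3)] by (simp add: M.minus_eq N.minus_eq)
qed

lemma rmod_hom_comp:
  assumes "f \<in> rmod_hom R M N" "g \<in> rmod_hom R N P"
  shows "(\<lambda>x. g (f x)) \<in> rmod_hom R M P"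
  using rmod_homD[OF assms(1)] rmod_homD[OF assms(2)] by (intro rmod_homI) auto

lemma rmod_hom_id: "(\<lambda>x. x) \<in> rmod_hom R M M"
  by (rule rmod_homI) auto

lemma rmod_hom_add:
  assumes "right_module R N" "f \<in> rmod_hom R M N" "g \<in> rmod_hom R M N"
  shows "(\<lambda>x. f x \<oplus>\<^bsub>N\<^esub> g x) \<in> rmod_hom R M N"
proof -
  interpret N: right_module R N by fact
  show ?thesis
    using rmod_homD[OF assms(2)] rmod_homD[OF assms(3)]
    by (intro rmod_homI) (auto simp: N.smult_r_distr N.a_ac)
qed

lemma rmod_hom_sub:
  assumes "right_module R N" "f \<in> rmod_hom R M N" "g \<in> rmod_hom R M N"
  shows "(\<lambda>x. f x \<ominus>\<^bsub>N\<^esub> g x) \<in> rmod_hom R M N"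
proof -
  interpret N: right_module R N by fact
  show ?thesis
    using rmod_homD[OF assms(2)] rmod_homD[OF assms(3)]
    by (intro rmod_homI) (auto simp: N.smult_r_distr N.smult_r_minus N.a_ac N.minus_eq N.minus_add)
qed

lemma rmod_hom_inv_into:
  assumes M: "right_module R M" and f: "f \<in> rmod_hom R M N"
    and bij: "bij_betw f (carrier M) (carrier N)"
  shows "inv_into (carrier M) f \<in> rmod_hom R N M"
proof -
  interpret M: right_module R M by fact
  let ?g = "inv_into (carrier M) f"
  note fD = rmod_homD[OF f]
  have g: "?g y \<in> carrier M" "f (?g y) = y" if "y \<in> carrier N" for y
    using bij that by (auto simp: bij_betw_def inv_into_into f_inv_into_f)
  have fg: "?g (f x) = x" if "x \<in> carrier M" for x
    using bij that by (auto simp: bij_betw_def)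
  show ?thesis
  proof (rule rmod_homI)
    fix x y assume xy: "x \<in> carrier N" "y \<in> carrier N"
    then show "?g (x \<oplus>\<^bsub>N\<^esub> y) = ?g x \<oplus>\<^bsub>M\<^esub> ?g y"
      using fg[of "?g x \<oplus>\<^bsub>M\<^esub> ?g y"] fD(2)[of "?g x" "?g y"] g by simp
  next
    fix a x assume "a \<in> carrier R" "x \<in> carrier N"
    then show "?g (a \<odot>\<^bsub>N\<^esub> x) = a \<odot>\<^bsub>M\<^esub> ?g x"
      using fg[of "a \<odot>\<^bsub>M\<^esub> ?g x"] fD(3)[of a "?g x"] g by simp
  qed (rule g)
qed

lemma submodule_equalizer:
  assumes M: "right_module R M" and N: "right_module R N"
    and f: "f \<in> rmod_hom R M N" and g: "g \<in> rmod_hom R M N"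
  shows "submodule {x \<in> carrier M. f x = g x} R M"
proof -
  interpret M: right_module R M by fact
  show ?thesis unfolding M.submodule_iff
    using rmod_homD[OF f] rmod_homD[OF g] rmod_hom_zero[OF M N f] rmod_hom_zero[OF M N g] by auto
qed

lemma submodule_image:
  assumes M: "right_module R M" and N: "right_module R N"
    and f: "f \<in> rmod_hom R M N" and H: "submodule H R M"
  shows "submodule (f ` H) R N"
proof -
  interpret M: right_module R M by fact
  interpret N: right_module R N by fact
  note HD = M.submoduleD[OF H]
  have "f x \<oplus>\<^bsub>N\<^esub> f y \<in> f ` H" if "x \<in> H" "y \<in> H" for x y
    using that HD rmod_homD(2)[OF f, of x y] by (metis image_eqI)
  moreover have "a \<odot>\<^bsub>N\<^esub> f x \<in> f ` H" if "a \<in> carrier R" "x \<in> H" for a x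
    using that HD rmod_homD(3)[OF f, of a x] by (metis image_eqI)
  moreover have "\<zero>\<^bsub>N\<^esub> \<in> f ` H"
    using HD rmod_hom_zero[OF M N f] by (metis image_eqI)
  ultimately show ?thesis
    unfolding N.submodule_iff using rmod_homD(1)[OF f] HD by auto
qed

lemma submodule_vimage:
  assumes M: "right_module R M" and N: "right_module R N"
    and f: "f \<in> rmod_hom R M N" and H: "submodule H R N"
  shows "submodule {x \<in> carrier M. f x \<in> H} R M"
proof -
  interpret M: right_module R M by fact
  interpret N: right_module R N by fact
  show ?thesis
    unfolding M.submodule_iff
    using rmod_homD[OF f] N.submoduleD[OF H] rmod_hom_zero[OF M N f] by auto
qed

text \<open>
  Direct summands are the images of idempotent endomorphisms, so decompositions can be produced
  and consumed by writing down endomorphisms.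
\<close>

lemma direct_summand_iff_projection:
  assumes M: "right_module R M"
  shows "direct_summand A R M \<longleftrightarrow> A \<subseteq> carrier M \<and>
    (\<exists>p\<in>rmod_hom R M M. (\<forall>x\<in>carrier M. p x \<in> A) \<and> (\<forall>x\<in>A. p x = x))"
proof -
  interpret M: right_module R M by fact
  show ?thesis
  proof (intro iffI conjI)
    assume "direct_summand A R M"
    then obtain B where A: "submodule A R M" and B: "submodule B R M"
      and AB: "A \<inter> B = {\<zero>\<^bsub>M\<^esub>}" and sum: "A <+>\<^bsub>M\<^esub> B = carrier M"
      unfolding direct_summand_def by blast
    note AD = M.submoduleD[OF A] and BD = M.submoduleD[OF B]
    show "A \<subseteq> carrier M" by (rule AD)
    have unique: "a = a'" if "a \<in> A" "a' \<in> A" "x \<ominus>\<^bsub>M\<^esub> a \<in> B" "x \<ominus>\<^bsub>M\<^esub> a' \<in> B" "x \<in> carrier M" for a a' x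
    proof -
      have m: "(\<ominus>\<^bsub>R\<^esub> \<one>\<^bsub>R\<^esub>) \<odot>\<^bsub>M\<^esub> z = \<ominus>\<^bsub>M\<^esub> z" if "z \<in> carrier M" for z
        using that by (simp add: M.smult_l_minus)
      have neg: "\<ominus>\<^bsub>R\<^esub> \<one>\<^bsub>R\<^esub> \<in> carrier R" by simp
      have "a \<ominus>\<^bsub>M\<^esub> a' \<in> A"
        using that AD(4)[OF that(1) AD(5)[OF neg that(2)]] AD(3) by (simp add: m M.minus_eq)
      moreover have "a \<ominus>\<^bsub>M\<^esub> a' = (x \<ominus>\<^bsub>M\<^esub> a') \<oplus>\<^bsub>M\<^esub> \<ominus>\<^bsub>M\<^esub> (x \<ominus>\<^bsub>M\<^esub> a)"
        using that AD(3) by algebra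
      then have "a \<ominus>\<^bsub>M\<^esub> a' \<in> B"
        using that BD(4)[OF that(4) BD(5)[OF neg that(3)]] BD(3) by (simp add: m)
      ultimately show ?thesis using AB that AD(3) M.diff_eq_zero_iff by blast
    qed
    have ex: "\<exists>a\<in>A. x \<ominus>\<^bsub>M\<^esub> a \<in> B" if x: "x \<in> carrier M" for x
    proof -
      obtain a b where "a \<in> A" "b \<in> B" "x = a \<oplus>\<^bsub>M\<^esub> b"
        using x unfolding sum[symmetric] set_add_def' by auto
      moreover have "a \<oplus>\<^bsub>M\<^esub> b \<ominus>\<^bsub>M\<^esub> a = b"
        using AD(3)[OF \<open>a \<in> A\<close>] BD(3)[OF \<open>b \<in> B\<close>] by algebra
      ultimately show ?thesis by metis
    qed
    define p where "p x = (SOME a. a \<in> A \<and> x \<ominus>\<^bsub>M\<^esub> a \<in> B)" for x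
    have p: "p x \<in> A" "x \<ominus>\<^bsub>M\<^esub> p x \<in> B" if "x \<in> carrier M" for x
      using someI_ex[of "\<lambda>a. a \<in> A \<and> x \<ominus>\<^bsub>M\<^esub> a \<in> B"] ex[OF that] unfolding p_def by blast+
    have pI: "p x = a" if "x \<in> carrier M" "a \<in> A" "x \<ominus>\<^bsub>M\<^esub> a \<in> B" for x a
      using unique p that by blast
    have "p \<in> rmod_hom R M M"
    proof (rule rmod_homI)
      fix x y assume xy: "x \<in> carrier M" "y \<in> carrier M"
      have "x \<oplus>\<^bsub>M\<^esub> y \<ominus>\<^bsub>M\<^esub> (p x \<oplus>\<^bsub>M\<^esub> p y) = (x \<ominus>\<^bsub>M\<^esub> p x) \<oplus>\<^bsub>M\<^esub> (y \<ominus>\<^bsub>M\<^esub> p y)"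
        using xy p(1)[THEN AD(3)] by algebra
      then show "p (x \<oplus>\<^bsub>M\<^esub> y) = p x \<oplus>\<^bsub>M\<^esub> p y"
        using xy p AD BD by (intro pI) auto
    next
      fix a x assume ax: "a \<in> carrier R" "x \<in> carrier M"
      then have "a \<odot>\<^bsub>M\<^esub> x \<ominus>\<^bsub>M\<^esub> a \<odot>\<^bsub>M\<^esub> p x = a \<odot>\<^bsub>M\<^esub> (x \<ominus>\<^bsub>M\<^esub> p x)"
        using p(1)[THEN AD(3)] by (simp add: M.smult_r_diff)
      then show "p (a \<odot>\<^bsub>M\<^esub> x) = a \<odot>\<^bsub>M\<^esub> p x"
        using ax p AD BD by (intro pI) auto
    qed (use p AD in auto)
    moreover have "p x = x" if "x \<in> A" for x
      using that AD(3) BD(2) by (intro pI) (auto simp: M.minus_eq M.r_neg)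
    ultimately show "\<exists>p\<in>rmod_hom R M M. (\<forall>x\<in>carrier M. p x \<in> A) \<and> (\<forall>x\<in>A. p x = x)"
      using p by blast
  next
    assume "A \<subseteq> carrier M \<and>
      (\<exists>p\<in>rmod_hom R M M. (\<forall>x\<in>carrier M. p x \<in> A) \<and> (\<forall>x\<in>A. p x = x))"
    then obtain p where AM: "A \<subseteq> carrier M" and p: "p \<in> rmod_hom R M M"
      and pA: "\<And>x. x \<in> carrier M \<Longrightarrow> p x \<in> A" and px: "\<And>x. x \<in> A \<Longrightarrow> p x = x" by blast
    define B where "B = {x \<in> carrier M. p x = p \<zero>\<^bsub>M\<^esub>}"
    have p0: "p \<zero>\<^bsub>M\<^esub> = \<zero>\<^bsub>M\<^esub>" using rmod_hom_zero M p by blast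
    have "{x \<in> carrier M. p x = x} = A" using AM pA px by auto metis
    then have A: "submodule A R M"
      using submodule_equalizer[OF M M p rmod_hom_id] by simp
    have "(\<lambda>x. \<zero>\<^bsub>M\<^esub>) \<in> rmod_hom R M M" by (rule rmod_homI) auto
    then have B: "submodule B R M"
      using submodule_equalizer[OF M M p] p0 unfolding B_def by auto
    have "x = p x \<oplus>\<^bsub>M\<^esub> (x \<ominus>\<^bsub>M\<^esub> p x)" "x \<ominus>\<^bsub>M\<^esub> p x \<in> B" if x: "x \<in> carrier M" for x
    proof -
      have px': "p x \<in> carrier M" using x pA AM by auto
      show "x = p x \<oplus>\<^bsub>M\<^esub> (x \<ominus>\<^bsub>M\<^esub> p x)" using x px' by algebra
      show "x \<ominus>\<^bsub>M\<^esub> p x \<in> B"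
        using x px' pA px p0 unfolding B_def
        by (auto simp: rmod_hom_diff[OF M M p] M.diff_eq_zero_iff)
    qed
    then have "carrier M \<subseteq> A <+>\<^bsub>M\<^esub> B" unfolding set_add_def' using pA by blast
    moreover have "A <+>\<^bsub>M\<^esub> B \<subseteq> carrier M"
      unfolding set_add_def' using AM by (auto simp: B_def)
    moreover have "A \<inter> B = {\<zero>\<^bsub>M\<^esub>}"
      using px p0 M.submoduleD(2)[OF A] by (auto simp: B_def)
    ultimately show "direct_summand A R M" using A B unfolding direct_summand_def by blast
  qed
qed

section \<open>Endomorphisms that are regular up to an essential kernel\<close>

text \<open>
  The condition on a module through which both sides of the theorem are compared: every
  endomorphism \<open>\<phi>\<close> has an endomorphism \<open>\<psi>\<close> with \<open>\<psi>\<phi>\<psi> = \<psi>\<close> for which the kernel of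
  \<open>\<phi> - \<phi>\<psi>\<phi>\<close> is essential, the latter in the elementwise form of \<open>essential_in_iff\<close>.
\<close>

definition regular_up_to_essential_kernel ::
  "('a, 'b) ring_scheme \<Rightarrow> ('a, 'm) module \<Rightarrow> bool"
  where "regular_up_to_essential_kernel R M \<longleftrightarrow>
    (\<forall>\<phi>\<in>rmod_hom R M M. \<exists>\<psi>\<in>rmod_hom R M M.
       (\<forall>x\<in>carrier M. \<psi> (\<phi> (\<psi> x)) = \<psi> x) \<and>
       (\<forall>x\<in>carrier M. x \<noteq> \<zero>\<^bsub>M\<^esub> \<longrightarrow>
          (\<exists>r\<in>carrier R. r \<odot>\<^bsub>M\<^esub> x \<noteq> \<zero>\<^bsub>M\<^esub> \<and> \<phi> (\<psi> (\<phi> (r \<odot>\<^bsub>M\<^esub> x))) = \<phi> (r \<odot>\<^bsub>M\<^esub> x))))"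

text \<open>
  The kernel of \<open>\<phi>\<close> is contained in that of the idempotent \<open>\<psi>\<phi>\<close>, and on the latter \<open>\<phi>\<close> agrees
  with \<open>\<phi> - \<phi>\<psi>\<phi>\<close>, whose kernel is essential.
\<close>

lemma CS_Rickart_if_regular_up_to_essential_kernel:
  assumes M: "right_module R M" and reg: "regular_up_to_essential_kernel R M"
  shows "CS_Rickart R M"
  unfolding CS_Rickart_def
proof
  interpret M: right_module R M by (rule M)
  fix \<phi> assume \<phi>: "\<phi> \<in> rmod_hom R M M"
  obtain \<psi> where \<psi>: "\<psi> \<in> rmod_hom R M M"
    and quasi: "\<forall>x\<in>carrier M. \<psi> (\<phi> (\<psi> x)) = \<psi> x"
    and ess: "\<forall>x\<in>carrier M. x \<noteq> \<zero>\<^bsub>M\<^esub> \<longrightarrow>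
      (\<exists>r\<in>carrier R. r \<odot>\<^bsub>M\<^esub> x \<noteq> \<zero>\<^bsub>M\<^esub> \<and> \<phi> (\<psi> (\<phi> (r \<odot>\<^bsub>M\<^esub> x))) = \<phi> (r \<odot>\<^bsub>M\<^esub> x))"
    using bspec[OF reg[unfolded regular_up_to_essential_kernel_def] \<phi>]
    by (elim bexE conjE) (rule that)
  note \<phi>D = rmod_homD[OF \<phi>] and \<psi>D = rmod_homD[OF \<psi>]
  have zero: "\<phi> \<zero>\<^bsub>M\<^esub> = \<zero>\<^bsub>M\<^esub>" "\<psi> \<zero>\<^bsub>M\<^esub> = \<zero>\<^bsub>M\<^esub>" using rmod_hom_zero M \<phi> \<psi> by blast+
  have e: "(\<lambda>x. \<psi> (\<phi> x)) \<in> rmod_hom R M M" using rmod_hom_comp \<phi> \<psi> by blast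
  have zero_hom: "(\<lambda>x. \<zero>\<^bsub>M\<^esub>) \<in> rmod_hom R M M" by (rule rmod_homI) auto
  \<comment> \<open>\<open>\<psi>\<phi>\<close> is idempotent, and the required summand is the image of \<open>1 - \<psi>\<phi>\<close>.\<close>
  define D where "D = {x \<in> carrier M. \<psi> (\<phi> x) = \<zero>\<^bsub>M\<^esub>}"
  have "direct_summand D R M"
    unfolding direct_summand_iff_projection[OF M]
  proof (intro conjI bexI[of _ "\<lambda>x. x \<ominus>\<^bsub>M\<^esub> \<psi> (\<phi> x)"] ballI)
    show "(\<lambda>x. x \<ominus>\<^bsub>M\<^esub> \<psi> (\<phi> x)) \<in> rmod_hom R M M"
      using rmod_hom_sub[OF M rmod_hom_id e] .
    show "x \<ominus>\<^bsub>M\<^esub> \<psi> (\<phi> x) \<in> D" if "x \<in> carrier M" for x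
      using that \<phi>D(1) \<psi>D(1) quasi
      by (simp add: D_def rmod_hom_diff[OF M M e] M.diff_eq_zero_iff)
  qed (auto simp: D_def M.minus_eq)
  moreover have "essential_in (a_kernel M M \<phi>) D R M"
  proof (subst essential_in_iff[OF M])
    show "submodule D R M"
      using submodule_equalizer[OF M M e zero_hom] by (simp add: D_def)
    show "submodule (a_kernel M M \<phi>) R M"
      using submodule_equalizer[OF M M \<phi> zero_hom] by (simp add: a_kernel_def')
    show "a_kernel M M \<phi> \<subseteq> D" by (auto simp: a_kernel_def' D_def zero)
    show "\<forall>x\<in>D. x \<noteq> \<zero>\<^bsub>M\<^esub> \<longrightarrow>
        (\<exists>r\<in>carrier R. r \<odot>\<^bsub>M\<^esub> x \<noteq> \<zero>\<^bsub>M\<^esub> \<and> r \<odot>\<^bsub>M\<^esub> x \<in> a_kernel M M \<phi>)"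
    proof (intro ballI impI)
      fix x assume x: "x \<in> D" "x \<noteq> \<zero>\<^bsub>M\<^esub>"
      then have xM: "x \<in> carrier M" "\<psi> (\<phi> x) = \<zero>\<^bsub>M\<^esub>" by (auto simp: D_def)
      obtain r where r: "r \<in> carrier R" "r \<odot>\<^bsub>M\<^esub> x \<noteq> \<zero>\<^bsub>M\<^esub>"
        "\<phi> (\<psi> (\<phi> (r \<odot>\<^bsub>M\<^esub> x))) = \<phi> (r \<odot>\<^bsub>M\<^esub> x)" using ess xM x by blast
      moreover have "\<psi> (\<phi> (r \<odot>\<^bsub>M\<^esub> x)) = \<zero>\<^bsub>M\<^esub>"
        using xM r rmod_homD(3)[OF e] by simp
      ultimately show "\<exists>r\<in>carrier R. r \<odot>\<^bsub>M\<^esub> x \<noteq> \<zero>\<^bsub>M\<^esub> \<and> r \<odot>\<^bsub>M\<^esub> x \<in> a_kernel M M \<phi>"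
        using xM zero by (auto simp: a_kernel_def' intro!: bexI[of _ r])
    qed
  qed
  ultimately show "\<exists>D. direct_summand D R M \<and> essential_in (a_kernel M M \<phi>) D R M" by blast
qed

text \<open>
  Let \<open>N\<close> be isomorphic to a summand \<open>A\<close>, and let \<open>\<phi>\<close> be the projection \<open>p\<close> onto \<open>A\<close> followed by the
  isomorphism to \<open>N\<close>, so that \<open>\<phi>\<close> has image \<open>N\<close> and is injective on \<open>A\<close>.  An element \<open>y\<close> of \<open>A\<close>
  with \<open>\<psi>\<phi>(y) = 0\<close> vanishes, because otherwise some nonzero multiple of \<open>y\<close> would lie in the
  kernel of \<open>\<phi> - \<phi>\<psi>\<phi>\<close>, hence in that of \<open>\<phi>\<close>.  This forces \<open>\<phi>\<psi>\<phi> = \<phi>\<close>, and then \<open>\<phi>\<psi>\<close> is a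
  projection onto \<open>N\<close>.
\<close>

lemma C2_module_if_regular_up_to_essential_kernel:
  assumes M: "right_module R M" and reg: "regular_up_to_essential_kernel R M"
  shows "C2_module R M"
  unfolding C2_module_def
proof (intro allI impI, elim conjE)
  interpret M: right_module R M by (rule M)
  fix N A
  assume N: "submodule N R M" and A: "direct_summand A R M"
    and "rmod_iso R (M\<lparr>carrier := N\<rparr>) (M\<lparr>carrier := A\<rparr>)"
  then obtain g where g: "g \<in> rmod_hom R (M\<lparr>carrier := N\<rparr>) (M\<lparr>carrier := A\<rparr>)"
    and bij: "bij_betw g N A" unfolding rmod_iso_def by auto
  obtain p where AM: "A \<subseteq> carrier M" and p: "p \<in> rmod_hom R M M"
    and pA: "\<And>x. x \<in> carrier M \<Longrightarrow> p x \<in> A" and px: "\<And>x. x \<in> A \<Longrightarrow> p x = x"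
    using A unfolding direct_summand_iff_projection[OF M] by blast
  define k where "k = inv_into N g"
  have k: "k \<in> rmod_hom R (M\<lparr>carrier := A\<rparr>) (M\<lparr>carrier := N\<rparr>)"
    using rmod_hom_inv_into[OF M.submodule_right_module[OF N] g] bij by (simp add: k_def)
  have kN: "k x \<in> N" "k x \<in> carrier M" if "x \<in> A" for x
    using rmod_homD(1)[OF k, of x] that M.submoduleD(3)[OF N] by auto
  have kg: "k (g x) = x" "g x \<in> A" if "x \<in> N" for x
    using that bij by (auto simp: k_def bij_betw_def)
  have k0: "x = \<zero>\<^bsub>M\<^esub>" if "x \<in> A" "k x = \<zero>\<^bsub>M\<^esub>" for x
  proof -
    have "submodule A R M" using A by (simp add: direct_summand_def)
    then have "k \<zero>\<^bsub>M\<^esub> = \<zero>\<^bsub>M\<^esub>" "\<zero>\<^bsub>M\<^esub> \<in> A"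
      using rmod_hom_zero[OF M.submodule_right_module M.submodule_right_module k] N M.submoduleD(2)
      by auto
    moreover have "inj_on k A" using bij unfolding k_def
      by (metis bij_betw_def bij_betw_inv_into)
    ultimately show ?thesis using that by (metis inj_onD)
  qed
  define \<phi> where "\<phi> x = k (p x)" for x
  have "p \<in> rmod_hom R M (M\<lparr>carrier := A\<rparr>)"
    using rmod_homD[OF p] pA by (intro rmod_homI) auto
  from rmod_hom_comp[OF this k] have "\<phi> \<in> rmod_hom R M (M\<lparr>carrier := N\<rparr>)"
    unfolding \<phi>_def .
  then have \<phi>: "\<phi> \<in> rmod_hom R M M" and \<phi>N: "\<And>x. x \<in> carrier M \<Longrightarrow> \<phi> x \<in> N"
    using M.submoduleD(3)[OF N] by (auto simp: rmod_hom_def)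
  obtain \<psi> where \<psi>: "\<psi> \<in> rmod_hom R M M"
    and quasi: "\<forall>x\<in>carrier M. \<psi> (\<phi> (\<psi> x)) = \<psi> x"
    and ess: "\<forall>x\<in>carrier M. x \<noteq> \<zero>\<^bsub>M\<^esub> \<longrightarrow>
      (\<exists>r\<in>carrier R. r \<odot>\<^bsub>M\<^esub> x \<noteq> \<zero>\<^bsub>M\<^esub> \<and> \<phi> (\<psi> (\<phi> (r \<odot>\<^bsub>M\<^esub> x))) = \<phi> (r \<odot>\<^bsub>M\<^esub> x))"
    using bspec[OF reg[unfolded regular_up_to_essential_kernel_def] \<phi>]
    by (elim bexE conjE) (rule that)
  note \<phi>D = rmod_homD[OF \<phi>] and \<psi>D = rmod_homD[OF \<psi>]
  have zero: "\<phi> \<zero>\<^bsub>M\<^esub> = \<zero>\<^bsub>M\<^esub>" "\<psi> \<zero>\<^bsub>M\<^esub> = \<zero>\<^bsub>M\<^esub>" using rmod_hom_zero M \<phi> \<psi> by blast+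
  have \<phi>p: "\<phi> (p x) = \<phi> x" if "x \<in> carrier M" for x
    using that pA px by (simp add: \<phi>_def)
  \<comment> \<open>Apply the injectivity argument to the component in \<open>A\<close> of \<open>x - \<psi>\<phi>(x)\<close>.\<close>
  have regular: "\<phi> (\<psi> (\<phi> x)) = \<phi> x" if x: "x \<in> carrier M" for x
  proof -
    define y where "y = p (x \<ominus>\<^bsub>M\<^esub> \<psi> (\<phi> x))"
    have diff: "x \<ominus>\<^bsub>M\<^esub> \<psi> (\<phi> x) \<in> carrier M" using x \<phi>D(1) \<psi>D(1) by simp
    then have y: "y \<in> A" "y \<in> carrier M" using pA AM by (auto simp: y_def)
    have \<phi>y: "\<phi> y = \<phi> x \<ominus>\<^bsub>M\<^esub> \<phi> (\<psi> (\<phi> x))"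
      using x \<phi>D(1) \<psi>D(1) diff by (simp add: y_def \<phi>p rmod_hom_diff[OF M M \<phi>])
    then have "\<psi> (\<phi> y) = \<zero>\<^bsub>M\<^esub>"
      using x \<phi>D(1) \<psi>D(1) quasi by (simp add: rmod_hom_diff[OF M M \<psi>] M.diff_eq_zero_iff)
    then have \<psi>\<phi>y: "\<psi> (\<phi> (r \<odot>\<^bsub>M\<^esub> y)) = \<zero>\<^bsub>M\<^esub>" if "r \<in> carrier R" for r
      using that y \<phi>D \<psi>D by simp
    have "y = \<zero>\<^bsub>M\<^esub>"
    proof (rule ccontr)
      assume "y \<noteq> \<zero>\<^bsub>M\<^esub>"
      then obtain r where r: "r \<in> carrier R" "r \<odot>\<^bsub>M\<^esub> y \<noteq> \<zero>\<^bsub>M\<^esub>"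
        "\<phi> (\<psi> (\<phi> (r \<odot>\<^bsub>M\<^esub> y))) = \<phi> (r \<odot>\<^bsub>M\<^esub> y)" using ess y by blast
      have "p (r \<odot>\<^bsub>M\<^esub> y) = r \<odot>\<^bsub>M\<^esub> y" using rmod_homD(3)[OF p] px r y by simp
      moreover have "r \<odot>\<^bsub>M\<^esub> y \<in> A" using pA[of "r \<odot>\<^bsub>M\<^esub> y"] calculation r y by simp
      moreover have "\<phi> (r \<odot>\<^bsub>M\<^esub> y) = \<zero>\<^bsub>M\<^esub>" using r \<psi>\<phi>y zero by simp
      ultimately show False using r(2) k0[of "r \<odot>\<^bsub>M\<^esub> y"] by (simp add: \<phi>_def)
    qed
    then show ?thesis using \<phi>y zero x \<phi>D(1) \<psi>D(1) M.diff_eq_zero_iff by (metis (full_types))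
  qed
  show "direct_summand N R M"
    unfolding direct_summand_iff_projection[OF M]
  proof (intro conjI bexI[of _ "\<lambda>x. \<phi> (\<psi> x)"] ballI)
    show "(\<lambda>x. \<phi> (\<psi> x)) \<in> rmod_hom R M M" using rmod_hom_comp \<phi> \<psi> by blast
    show "\<phi> (\<psi> x) \<in> N" if "x \<in> carrier M" for x using that \<psi>D(1) \<phi>N by simp
    show "\<phi> (\<psi> x) = x" if "x \<in> N" for x
      using regular[of "g x"] kg[OF that] AM px by (auto simp: \<phi>_def)
  qed (rule M.submoduleD(1)[OF N])
qed

text \<open>
  Let the kernel of \<open>\<phi>\<close> be essential in the summand \<open>D\<close>, with complement \<open>C\<close>.  Then \<open>\<phi>\<close> is injective
  on \<open>C\<close>, so \<open>\<phi>(C)\<close> is a summand by the \<open>C\<^sub>2\<close> condition.  Let \<open>\<psi>\<close> project onto \<open>\<phi>(C)\<close> and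
  then invert \<open>\<phi>\<close> on \<open>C\<close>.  The kernel of \<open>\<phi> - \<phi>\<psi>\<phi>\<close> contains both \<open>C\<close> and the kernel of \<open>\<phi>\<close>,
  and the sum of these two is essential in \<open>D + C\<close>.
\<close>

lemma regular_up_to_essential_kernel_if_CS_Rickart_C2:
  assumes M: "right_module R M" and CS: "CS_Rickart R M" and C2: "C2_module R M"
  shows "regular_up_to_essential_kernel R M"
  unfolding regular_up_to_essential_kernel_def
proof
  interpret M: right_module R M by (rule M)
  fix \<phi> assume \<phi>: "\<phi> \<in> rmod_hom R M M"
  then obtain D where D: "direct_summand D R M" and ess: "essential_in (a_kernel M M \<phi>) D R M"
    using CS unfolding CS_Rickart_def by blast
  obtain p where DM: "D \<subseteq> carrier M" and p: "p \<in> rmod_hom R M M"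
    and pD: "\<And>x. x \<in> carrier M \<Longrightarrow> p x \<in> D" and px: "\<And>x. x \<in> D \<Longrightarrow> p x = x"
    using D unfolding direct_summand_iff_projection[OF M] by blast
  note \<phi>D = rmod_homD[OF \<phi>] and pHom = rmod_homD[OF p]
  have p0: "p \<zero>\<^bsub>M\<^esub> = \<zero>\<^bsub>M\<^esub>" using rmod_hom_zero M p by blast
  have \<phi>0: "\<phi> \<zero>\<^bsub>M\<^esub> = \<zero>\<^bsub>M\<^esub>" using rmod_hom_zero M \<phi> by blast
  define C where "C = {x \<in> carrier M. p x = \<zero>\<^bsub>M\<^esub>}"
  have qC: "x \<ominus>\<^bsub>M\<^esub> p x \<in> C" if "x \<in> carrier M" for x
    using that pHom(1) pD px by (simp add: C_def rmod_hom_diff[OF M M p] M.diff_eq_zero_iff)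
  have C: "direct_summand C R M"
    unfolding direct_summand_iff_projection[OF M]
  proof (intro conjI bexI[of _ "\<lambda>x. x \<ominus>\<^bsub>M\<^esub> p x"] ballI)
    show "(\<lambda>x. x \<ominus>\<^bsub>M\<^esub> p x) \<in> rmod_hom R M M" using rmod_hom_sub[OF M rmod_hom_id p] .
  qed (use qC in \<open>auto simp: C_def M.minus_eq\<close>)
  then have Csub: "submodule C R M" unfolding direct_summand_def by blast
  have CM: "x \<in> carrier M" if "x \<in> C" for x using that by (simp add: C_def)
  have inj: "inj_on \<phi> C"
  proof (rule inj_onI)
    fix x y assume xy: "x \<in> C" "y \<in> C" "\<phi> x = \<phi> y"
    then have "x \<ominus>\<^bsub>M\<^esub> y \<in> a_kernel M M \<phi>"
      using CM \<phi>D(1) by (simp add: a_kernel_def' rmod_hom_diff[OF M M \<phi>] M.diff_eq_zero_iff)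
    then have "x \<ominus>\<^bsub>M\<^esub> y \<in> D" using ess unfolding essential_in_def by blast
    then have "x \<ominus>\<^bsub>M\<^esub> y = p (x \<ominus>\<^bsub>M\<^esub> y)" using px by simp
    also have "\<dots> = \<zero>\<^bsub>M\<^esub>"
      using xy by (simp add: C_def rmod_hom_diff[OF M M p] M.diff_eq_zero_iff)
    finally show "x = y" using xy CM M.diff_eq_zero_iff by blast
  qed
  define N where "N = \<phi> ` C"
  have Nsub: "submodule N R M" unfolding N_def by (rule submodule_image[OF M M \<phi> Csub])
  have NM: "x \<in> carrier M" if "x \<in> N" for x using that \<phi>D(1) CM by (auto simp: N_def)
  have \<phi>CN: "\<phi> \<in> rmod_hom R (M\<lparr>carrier := C\<rparr>) (M\<lparr>carrier := N\<rparr>)"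
    using \<phi>D CM by (intro rmod_homI) (auto simp: N_def)
  have bij: "bij_betw \<phi> C N" using inj by (simp add: bij_betw_def N_def)
  define k where "k = inv_into C \<phi>"
  have k: "k \<in> rmod_hom R (M\<lparr>carrier := N\<rparr>) (M\<lparr>carrier := C\<rparr>)"
    using rmod_hom_inv_into[OF M.submodule_right_module[OF Csub] \<phi>CN] bij by (simp add: k_def)
  have "bij_betw k N C" using bij_betw_inv_into[OF bij] by (simp add: k_def)
  with k have "rmod_iso R (M\<lparr>carrier := N\<rparr>) (M\<lparr>carrier := C\<rparr>)" unfolding rmod_iso_def by auto
  then have "direct_summand N R M" using C2 C Nsub unfolding C2_module_def by blast
  then obtain \<pi> where \<pi>: "\<pi> \<in> rmod_hom R M M"
    and \<pi>N: "\<And>x. x \<in> carrier M \<Longrightarrow> \<pi> x \<in> N" and \<pi>x: "\<And>x. x \<in> N \<Longrightarrow> \<pi> x = x"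
    unfolding direct_summand_iff_projection[OF M] by blast
  have \<phi>k: "\<phi> (k x) = x" "k x \<in> C" if "x \<in> N" for x
    using that bij by (auto simp: k_def bij_betw_def f_inv_into_f inv_into_into)
  have k\<phi>: "k (\<phi> x) = x" if "x \<in> C" for x using that inj by (simp add: k_def)
  define \<psi> where "\<psi> x = k (\<pi> x)" for x
  have "\<pi> \<in> rmod_hom R M (M\<lparr>carrier := N\<rparr>)"
    using rmod_homD[OF \<pi>] \<pi>N by (intro rmod_homI) auto
  from rmod_hom_comp[OF this k] have "\<psi> \<in> rmod_hom R M (M\<lparr>carrier := C\<rparr>)"
    unfolding \<psi>_def .
  then have \<psi>: "\<psi> \<in> rmod_hom R M M" using CM by (auto simp: rmod_hom_def)
  have \<psi>\<phi>: "\<psi> (\<phi> x) = x" if "x \<in> C" for x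
    using that \<pi>x k\<phi> by (simp add: \<psi>_def N_def)
  have "\<psi> (\<phi> (\<psi> x)) = \<psi> x" if "x \<in> carrier M" for x
    using that \<pi>N \<phi>k by (intro \<psi>\<phi>) (simp add: \<psi>_def)
  moreover have "\<exists>r\<in>carrier R. r \<odot>\<^bsub>M\<^esub> x \<noteq> \<zero>\<^bsub>M\<^esub> \<and> \<phi> (\<psi> (\<phi> (r \<odot>\<^bsub>M\<^esub> x))) = \<phi> (r \<odot>\<^bsub>M\<^esub> x)"
    if x: "x \<in> carrier M" "x \<noteq> \<zero>\<^bsub>M\<^esub>" for x
  proof (cases "p x = \<zero>\<^bsub>M\<^esub>")
    case True
    then show ?thesis using x \<psi>\<phi>[of x] by (intro bexI[of _ "\<one>\<^bsub>R\<^esub>"]) (auto simp: C_def)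
  next
    case False
    have sub: "submodule (a_kernel M M \<phi>) R M" "submodule D R M" "a_kernel M M \<phi> \<subseteq> D"
      using ess unfolding essential_in_def by auto
    obtain r where r: "r \<in> carrier R" "r \<odot>\<^bsub>M\<^esub> p x \<noteq> \<zero>\<^bsub>M\<^esub>" "r \<odot>\<^bsub>M\<^esub> p x \<in> a_kernel M M \<phi>"
      using False x pD ess unfolding essential_in_iff[OF M sub] by blast
    define z where "z = r \<odot>\<^bsub>M\<^esub> x"
    have z: "z \<in> carrier M" "p z = r \<odot>\<^bsub>M\<^esub> p x" using r x pHom by (auto simp: z_def)
    then have pz: "p z \<noteq> \<zero>\<^bsub>M\<^esub>" "\<phi> (p z) = \<zero>\<^bsub>M\<^esub>" using r by (auto simp: a_kernel_def')
    have "\<phi> (z \<ominus>\<^bsub>M\<^esub> p z) = \<phi> z"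
      using z(1) pz(2) pHom(1) \<phi>D(1) by (subst rmod_hom_diff[OF M M \<phi>]) (simp_all add: M.minus_eq)
    then have "\<phi> (\<psi> (\<phi> z)) = \<phi> z" using \<psi>\<phi>[OF qC[OF z(1)]] by simp
    moreover have "z \<noteq> \<zero>\<^bsub>M\<^esub>" using pz p0 by auto
    ultimately show ?thesis using r(1) by (auto simp: z_def)
  qed
  ultimately show "\<exists>\<psi>\<in>rmod_hom R M M. (\<forall>x\<in>carrier M. \<psi> (\<phi> (\<psi> x)) = \<psi> x) \<and>
      (\<forall>x\<in>carrier M. x \<noteq> \<zero>\<^bsub>M\<^esub> \<longrightarrow>
        (\<exists>r\<in>carrier R. r \<odot>\<^bsub>M\<^esub> x \<noteq> \<zero>\<^bsub>M\<^esub> \<and> \<phi> (\<psi> (\<phi> (r \<odot>\<^bsub>M\<^esub> x))) = \<phi> (r \<odot>\<^bsub>M\<^esub> x)))"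
    using \<psi> by (intro bexI[of _ \<psi>]) auto
qed

text \<open>
  This lets \<open>algebra\<close> normalise the products \<open>x1\<close> that arise from right factors \<open>1 - y\<close>.
\<close>

lemmas (in ring) ring_right_one
  [algebra ring "zero R" "add R" "a_inv R" "a_minus R" "one R" "mult R"] = r_one

section \<open>Singular elements\<close>

text \<open>
  The singular submodule: essentiality of the annihilator, a right ideal, is written out elementwise.
\<close>

definition singular_elements :: "('a, 'b) ring_scheme \<Rightarrow> ('a, 'm) module \<Rightarrow> 'm set"
  where "singular_elements R M =
    {x \<in> carrier M. \<forall>a\<in>carrier R. a \<noteq> \<zero>\<^bsub>R\<^esub> \<longrightarrow>
       (\<exists>r\<in>carrier R. a \<otimes>\<^bsub>R\<^esub> r \<noteq> \<zero>\<^bsub>R\<^esub> \<and> (a \<otimes>\<^bsub>R\<^esub> r) \<odot>\<^bsub>M\<^esub> x = \<zero>\<^bsub>M\<^esub>)}"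

lemma singular_elementsD:
  assumes "x \<in> singular_elements R M"
  shows "x \<in> carrier M"
    "\<And>a. a \<in> carrier R \<Longrightarrow> a \<noteq> \<zero>\<^bsub>R\<^esub> \<Longrightarrow>
      \<exists>r\<in>carrier R. a \<otimes>\<^bsub>R\<^esub> r \<noteq> \<zero>\<^bsub>R\<^esub> \<and> (a \<otimes>\<^bsub>R\<^esub> r) \<odot>\<^bsub>M\<^esub> x = \<zero>\<^bsub>M\<^esub>"
  using assms unfolding singular_elements_def by auto

text \<open>
  For sums the two conditions are met one after the other.  For \<open>xb\<close> and \<open>a \<noteq> 0\<close>, either \<open>ba = 0\<close>
  and \<open>a\<close> itself annihilates \<open>xb\<close>, or the condition for \<open>x\<close> is applied to \<open>ba\<close>.
\<close>

lemma submodule_singular_elements: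
  assumes M: "right_module R M"
  shows "submodule (singular_elements R M) R M"
proof -
  interpret M: right_module R M by (rule M)
  show ?thesis unfolding M.submodule_iff
  proof (intro conjI ballI)
    show "\<zero>\<^bsub>M\<^esub> \<in> singular_elements R M"
      unfolding singular_elements_def by (auto intro!: bexI[of _ "\<one>\<^bsub>R\<^esub>"])
  next
    fix x y assume x: "x \<in> singular_elements R M" and y: "y \<in> singular_elements R M"
    note xD = singular_elementsD[OF x] and yD = singular_elementsD[OF y]
    have "\<exists>r\<in>carrier R. a \<otimes>\<^bsub>R\<^esub> r \<noteq> \<zero>\<^bsub>R\<^esub> \<and> (a \<otimes>\<^bsub>R\<^esub> r) \<odot>\<^bsub>M\<^esub> (x \<oplus>\<^bsub>M\<^esub> y) = \<zero>\<^bsub>M\<^esub>"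
      if a: "a \<in> carrier R" "a \<noteq> \<zero>\<^bsub>R\<^esub>" for a
    proof -
      obtain r where r: "r \<in> carrier R" "a \<otimes>\<^bsub>R\<^esub> r \<noteq> \<zero>\<^bsub>R\<^esub>" "(a \<otimes>\<^bsub>R\<^esub> r) \<odot>\<^bsub>M\<^esub> x = \<zero>\<^bsub>M\<^esub>"
        using xD(2) a by blast
      obtain s where s: "s \<in> carrier R" "a \<otimes>\<^bsub>R\<^esub> r \<otimes>\<^bsub>R\<^esub> s \<noteq> \<zero>\<^bsub>R\<^esub>"
        "(a \<otimes>\<^bsub>R\<^esub> r \<otimes>\<^bsub>R\<^esub> s) \<odot>\<^bsub>M\<^esub> y = \<zero>\<^bsub>M\<^esub>"
        using yD(2)[of "a \<otimes>\<^bsub>R\<^esub> r"] a r by auto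
      have "(a \<otimes>\<^bsub>R\<^esub> r \<otimes>\<^bsub>R\<^esub> s) \<odot>\<^bsub>M\<^esub> x = \<zero>\<^bsub>M\<^esub>"
        using a r s(1) xD(1) by (subst M.smult_assoc) auto
      then show ?thesis
        using a r s xD(1) yD(1)
        by (intro bexI[of _ "r \<otimes>\<^bsub>R\<^esub> s"]) (auto simp: M.smult_r_distr M.R.m_assoc)
    qed
    then show "x \<oplus>\<^bsub>M\<^esub> y \<in> singular_elements R M"
      using xD(1) yD(1) unfolding singular_elements_def by auto
  next
    fix b x assume b: "b \<in> carrier R" and x: "x \<in> singular_elements R M"
    note xD = singular_elementsD[OF x]
    have "\<exists>r\<in>carrier R. a \<otimes>\<^bsub>R\<^esub> r \<noteq> \<zero>\<^bsub>R\<^esub> \<and> (a \<otimes>\<^bsub>R\<^esub> r) \<odot>\<^bsub>M\<^esub> (b \<odot>\<^bsub>M\<^esub> x) = \<zero>\<^bsub>M\<^esub>"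
      if a: "a \<in> carrier R" "a \<noteq> \<zero>\<^bsub>R\<^esub>" for a
    proof (cases "b \<otimes>\<^bsub>R\<^esub> a = \<zero>\<^bsub>R\<^esub>")
      case True
      then show ?thesis
        using a b xD(1) by (intro bexI[of _ "\<one>\<^bsub>R\<^esub>"]) (auto simp flip: M.smult_assoc)
    next
      case False
      then obtain r where r: "r \<in> carrier R" "b \<otimes>\<^bsub>R\<^esub> a \<otimes>\<^bsub>R\<^esub> r \<noteq> \<zero>\<^bsub>R\<^esub>"
        "(b \<otimes>\<^bsub>R\<^esub> a \<otimes>\<^bsub>R\<^esub> r) \<odot>\<^bsub>M\<^esub> x = \<zero>\<^bsub>M\<^esub>"
        using xD(2)[of "b \<otimes>\<^bsub>R\<^esub> a"] a b by auto
      then show ?thesis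
        using a b xD(1)
        by (intro bexI[of _ r]) (auto simp: M.R.m_assoc simp flip: M.smult_assoc)
    qed
    then show "b \<odot>\<^bsub>M\<^esub> x \<in> singular_elements R M"
      using xD(1) b unfolding singular_elements_def by auto
  qed (auto simp: singular_elements_def)
qed

lemma rmod_hom_singular_elements:
  assumes M: "right_module R M" and N: "right_module R N" and f: "f \<in> rmod_hom R M N"
    and x: "x \<in> singular_elements R M"
  shows "f x \<in> singular_elements R N"
proof -
  interpret M: right_module R M by (rule M)
  note xD = singular_elementsD[OF x]
  have "\<exists>r\<in>carrier R. a \<otimes>\<^bsub>R\<^esub> r \<noteq> \<zero>\<^bsub>R\<^esub> \<and> (a \<otimes>\<^bsub>R\<^esub> r) \<odot>\<^bsub>N\<^esub> f x = \<zero>\<^bsub>N\<^esub>"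
    if a: "a \<in> carrier R" "a \<noteq> \<zero>\<^bsub>R\<^esub>" for a
  proof -
    obtain r where r: "r \<in> carrier R" "a \<otimes>\<^bsub>R\<^esub> r \<noteq> \<zero>\<^bsub>R\<^esub>" "(a \<otimes>\<^bsub>R\<^esub> r) \<odot>\<^bsub>M\<^esub> x = \<zero>\<^bsub>M\<^esub>"
      using xD(2) a by blast
    then show ?thesis
      using rmod_homD(3)[OF f, of "a \<otimes>\<^bsub>R\<^esub> r" x] xD(1) a rmod_hom_zero[OF M N f]
      by (intro bexI[of _ r]) auto
  qed
  then show ?thesis using xD(1) rmod_homD(1)[OF f] unfolding singular_elements_def by auto
qed

lemma right_regular_module_simps [simp]:
  "carrier (right_regular_module R) = carrier R"
  "\<zero>\<^bsub>right_regular_module R\<^esub> = \<zero>\<^bsub>R\<^esub>"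
  "x \<oplus>\<^bsub>right_regular_module R\<^esub> y = x \<oplus>\<^bsub>R\<^esub> y"
  "\<ominus>\<^bsub>right_regular_module R\<^esub> x = \<ominus>\<^bsub>R\<^esub> x"
  "x \<ominus>\<^bsub>right_regular_module R\<^esub> y = x \<ominus>\<^bsub>R\<^esub> y"
  "a \<odot>\<^bsub>right_regular_module R\<^esub> x = x \<otimes>\<^bsub>R\<^esub> a"
  by (simp_all add: right_regular_module_def a_minus_def a_inv_def m_inv_def)

context ring
begin

lemma right_regular_module: "right_module R (right_regular_module R)"
proof (intro right_module.intro abelian_groupI right_module_axioms.intro)
  fix x assume "x \<in> carrier (right_regular_module R)"
  then show "\<exists>y\<in>carrier (right_regular_module R).
      y \<oplus>\<^bsub>right_regular_module R\<^esub> x = \<zero>\<^bsub>right_regular_module R\<^esub>"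
    by (auto intro!: bexI[of _ "\<ominus> x"] simp: l_neg)
qed (auto simp: a_ac l_distr r_distr m_assoc ring_axioms)

lemma right_ideal_iff:
  "right_ideal I R \<longleftrightarrow> I \<subseteq> carrier R \<and> \<zero> \<in> I \<and>
    (\<forall>x\<in>I. \<forall>y\<in>I. x \<oplus> y \<in> I) \<and> (\<forall>a\<in>carrier R. \<forall>x\<in>I. x \<otimes> a \<in> I)"
  using right_module.submodule_iff[OF right_regular_module] by simp

lemma right_singular_ideal_eq:
  "right_singular_ideal R = singular_elements R (right_regular_module R)"
proof -
  let ?S = "right_regular_module R"
  have mul: "(\<lambda>y. x \<otimes> y) \<in> rmod_hom R ?S ?S" if "x \<in> carrier R" for x
    using that by (intro rmod_homI) (auto simp: r_distr m_assoc)
  have zero: "(\<lambda>y. \<zero>) \<in> rmod_hom R ?S ?S" by (rule rmod_homI) auto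
  have ann: "right_ideal (right_annihilator R x) R" if "x \<in> carrier R" for x
    using submodule_equalizer[OF right_regular_module right_regular_module mul[OF that] zero]
    by (simp add: right_annihilator_def)
  have full: "right_ideal (carrier R) R" by (auto simp: right_ideal_iff)
  have "essential_in (right_annihilator R x) (carrier R) R ?S \<longleftrightarrow>
     (\<forall>a\<in>carrier R. a \<noteq> \<zero> \<longrightarrow> (\<exists>r\<in>carrier R. a \<otimes> r \<noteq> \<zero> \<and> x \<otimes> (a \<otimes> r) = \<zero>))"
    if x: "x \<in> carrier R" for x
    using x by (subst essential_in_iff[OF right_regular_module ann[OF x] full])
      (auto simp: right_annihilator_def)
  then show ?thesis unfolding right_singular_ideal_def singular_elements_def by auto
qed

text \<open>
  Left multiplications are endomorphisms of the right module \<open>R\<close>, and homomorphisms preserve singular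
  elements.
\<close>

lemma right_singular_ideal_is_ideal: "ideal (right_singular_ideal R) R"
proof -
  let ?S = "right_regular_module R"
  have sub: "right_ideal (right_singular_ideal R) R"
    unfolding right_singular_ideal_eq by (rule submodule_singular_elements[OF right_regular_module])
  note * = sub[unfolded right_ideal_iff]
  have mul: "(\<lambda>y. x \<otimes> y) \<in> rmod_hom R ?S ?S" if "x \<in> carrier R" for x
    using that by (intro rmod_homI) (auto simp: r_distr m_assoc)
  show ?thesis
  proof (intro idealI ring_axioms)
    show "subgroup (right_singular_ideal R) (add_monoid R)"
    proof
      fix x assume x: "x \<in> right_singular_ideal R"
      then have "x \<otimes> \<ominus> \<one> \<in> right_singular_ideal R" using * by auto
      moreover have "x \<otimes> \<ominus> \<one> = \<ominus> x" using x * by (auto simp: r_minus)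
      ultimately show "inv\<^bsub>add_monoid R\<^esub> x \<in> right_singular_ideal R" by (simp add: a_inv_def)
    qed (use * in auto)
  next
    fix a x assume "a \<in> right_singular_ideal R" "x \<in> carrier R"
    then show "x \<otimes> a \<in> right_singular_ideal R"
      using rmod_hom_singular_elements[OF right_regular_module right_regular_module mul]
      unfolding right_singular_ideal_eq by blast
    show "a \<otimes> x \<in> right_singular_ideal R"
      using * \<open>a \<in> right_singular_ideal R\<close> \<open>x \<in> carrier R\<close> by blast
  qed
qed

section \<open>Units, maximal right ideals and the Jacobson radical\<close>

text \<open>
  Zorn's lemma: a union of a chain of right ideals that avoid \<open>1\<close> again avoids \<open>1\<close>.
\<close>

lemma proper_right_ideal_in_maximal:
  assumes I: "right_ideal I R" "\<one> \<notin> I"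
  shows "\<exists>K. maximal_right_ideal K R \<and> I \<subseteq> K"
proof -
  define \<A> where "\<A> = {K. right_ideal K R \<and> I \<subseteq> K \<and> \<one> \<notin> K}"
  have "\<exists>K\<in>\<A>. \<forall>X\<in>\<A>. K \<subseteq> X \<longrightarrow> X = K"
  proof (rule subset_Zorn_nonempty)
    show "\<A> \<noteq> {}" using I by (auto simp: \<A>_def)
  next
    fix \<C> assume \<C>: "\<C> \<noteq> {}" "subset.chain \<A> \<C>"
    then have sub: "\<And>K. K \<in> \<C> \<Longrightarrow> right_ideal K R \<and> I \<subseteq> K \<and> \<one> \<notin> K"
      and chain: "\<And>K L. K \<in> \<C> \<Longrightarrow> L \<in> \<C> \<Longrightarrow> K \<subseteq> L \<or> L \<subseteq> K"
      by (auto simp: \<A>_def subset.chain_def)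
    have "x \<oplus> y \<in> \<Union>\<C>" if xy: "x \<in> \<Union>\<C>" "y \<in> \<Union>\<C>" for x y
    proof -
      obtain K L where KL: "K \<in> \<C>" "L \<in> \<C>" "x \<in> K" "y \<in> L" using xy by blast
      then obtain P where "P \<in> \<C>" "x \<in> P" "y \<in> P" using chain[of K L] by blast
      then show ?thesis using sub[of P] by (auto simp: right_ideal_iff)
    qed
    moreover have "\<Union>\<C> \<subseteq> carrier R" "\<zero> \<in> \<Union>\<C>" "I \<subseteq> \<Union>\<C>" "\<one> \<notin> \<Union>\<C>"
      using sub \<C>(1) by (fastforce simp: right_ideal_iff)+
    moreover have "x \<otimes> a \<in> \<Union>\<C>" if "x \<in> \<Union>\<C>" "a \<in> carrier R" for x a
      using sub that unfolding right_ideal_iff by blast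
    ultimately show "\<Union>\<C> \<in> \<A>" unfolding \<A>_def by (auto simp: right_ideal_iff)
  qed
  then obtain K where K: "K \<in> \<A>" and max: "\<And>X. X \<in> \<A> \<Longrightarrow> K \<subseteq> X \<Longrightarrow> X = K" by blast
  have "maximal_right_ideal K R" unfolding maximal_right_ideal_def
  proof (intro conjI allI impI)
    show "right_ideal K R" "K \<noteq> carrier R" using K by (auto simp: \<A>_def)
    fix L assume L: "right_ideal L R \<and> K \<subseteq> L"
    show "L = K \<or> L = carrier R"
    proof (cases "\<one> \<in> L")
      case True
      then have "x \<in> L" if "x \<in> carrier R" for x
        using L that unfolding right_ideal_iff by (metis l_one)
      then show ?thesis using L by (auto simp: right_ideal_iff)
    next
      case False
      then show ?thesis using L K max[of L] by (auto simp: \<A>_def)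
    qed
  qed
  then show ?thesis using K by (auto simp: \<A>_def)
qed

lemma jacobson_radical_right_ideal: "right_ideal (jacobson_radical R) R"
  unfolding right_ideal_iff jacobson_radical_def maximal_right_ideal_def by auto

text \<open>
  A right ideal \<open>(1 - z)R\<close> with \<open>z\<close> in the radical lies in no maximal right ideal, as that would
  also contain \<open>z\<close> and hence \<open>1\<close>.  So every such \<open>1 - z\<close> has a right inverse.
\<close>

lemma one_minus_jacobson_radical_Units:
  assumes x: "x \<in> jacobson_radical R"
  shows "\<one> \<ominus> x \<in> Units R"
proof -
  let ?J = "jacobson_radical R"
  note J = jacobson_radical_right_ideal[unfolded right_ideal_iff]
  have right_inverse: "\<exists>y\<in>carrier R. (\<one> \<ominus> z) \<otimes> y = \<one>" if z: "z \<in> ?J" for z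
  proof -
    have zR: "z \<in> carrier R" using z J by auto
    let ?K = "{(\<one> \<ominus> z) \<otimes> y | y. y \<in> carrier R}"
    have K: "right_ideal ?K R"
      using right_module.cyclic_submodule[OF right_regular_module, of "\<one> \<ominus> z"] zR by simp
    have "\<one> \<in> ?K"
    proof (rule ccontr)
      assume "\<one> \<notin> ?K"
      then obtain L where L: "maximal_right_ideal L R" "?K \<subseteq> L"
        using proper_right_ideal_in_maximal[OF K] by blast
      note LD = L(1)[unfolded maximal_right_ideal_def right_ideal_iff]
      have "\<one> \<ominus> z \<in> L" using L(2) zR by (auto intro!: exI[of _ \<one>])
      moreover have "z \<in> L" using z L(1) by (auto simp: jacobson_radical_def)
      ultimately have "(\<one> \<ominus> z) \<oplus> z \<in> L" using LD by blast
      moreover have "(\<one> \<ominus> z) \<oplus> z = \<one>" using zR by algebra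
      ultimately have "\<one> \<in> L" by simp
      then have "carrier R \<subseteq> L" using LD by (metis l_one subsetI)
      then show False using LD by blast
    qed
    then show ?thesis by (auto intro: sym)
  qed
  have xR: "x \<in> carrier R" using x J by auto
  obtain y where y: "y \<in> carrier R" "(\<one> \<ominus> x) \<otimes> y = \<one>" using right_inverse[OF x] by blast
  \<comment> \<open>The right inverse is again of the form \<open>1 - z\<close> with \<open>z\<close> in the radical.\<close>
  have "x \<otimes> (\<ominus> y) \<in> ?J" using x y J by blast
  then obtain w where w: "w \<in> carrier R" "(\<one> \<ominus> x \<otimes> (\<ominus> y)) \<otimes> w = \<one>" using right_inverse by blast
  have "y = (\<one> \<ominus> x) \<otimes> y \<oplus> x \<otimes> y" using xR y(1) by algebra
  then have "y = \<one> \<oplus> x \<otimes> y" using y(2) by simp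
  also have "\<dots> = \<one> \<ominus> x \<otimes> (\<ominus> y)" using xR y(1) by algebra
  finally have "y \<otimes> w = \<one>" using w by simp
  then have "w = \<one> \<ominus> x"
    using y w xR by (metis l_one m_assoc minus_closed one_closed r_one)
  then show ?thesis using \<open>y \<otimes> w = \<one>\<close> y w xR unfolding Units_def by auto
qed

lemma von_neumann_regular_Quot_iff:
  assumes I: "ideal I R"
  shows "von_neumann_regular (R Quot I) \<longleftrightarrow>
    (\<forall>a\<in>carrier R. \<exists>b\<in>carrier R. I +> (a \<otimes> b \<otimes> a) = I +> a)"
proof -
  interpret I: ideal I R by (rule I)
  have "carrier (R Quot I) = (+>) I ` carrier R"
    by (auto simp: FactRing_def A_RCOSETS_def')
  moreover have "(I +> a) \<otimes>\<^bsub>R Quot I\<^esub> (I +> b) = I +> (a \<otimes> b)"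
    if "a \<in> carrier R" "b \<in> carrier R" for a b
    using that by (simp add: FactRing_def I.rcoset_mult_add)
  ultimately show ?thesis unfolding von_neumann_regular_def by auto
qed

lemma a_coset_eq_iff:
  assumes I: "ideal I R" and xy: "x \<in> carrier R" "y \<in> carrier R"
  shows "I +> x = I +> y \<longleftrightarrow> x \<ominus> y \<in> I"
  using quotient_eq_iff_same_a_r_cos[OF I xy] by auto

end

section \<open>Regularity of a ring modulo its right singular ideal\<close>

text \<open>
  The meeting point of the two sides of the theorem on the level of the ring.  The equation
  \<open>bab = b\<close> is what encodes the lifting of idempotents.
\<close>

definition regular_modulo_singular :: "('a, 'b) ring_scheme \<Rightarrow> bool"
  where "regular_modulo_singular R \<longleftrightarrow>
    (\<forall>a\<in>carrier R. \<exists>b\<in>carrier R. b \<otimes>\<^bsub>R\<^esub> a \<otimes>\<^bsub>R\<^esub> b = b \<and>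
       a \<ominus>\<^bsub>R\<^esub> a \<otimes>\<^bsub>R\<^esub> b \<otimes>\<^bsub>R\<^esub> a \<in> right_singular_ideal R)"

context ring
begin

lemma right_singular_ideal_iff:
  "z \<in> right_singular_ideal R \<longleftrightarrow> z \<in> carrier R \<and>
    (\<forall>a\<in>carrier R. a \<noteq> \<zero> \<longrightarrow> (\<exists>r\<in>carrier R. a \<otimes> r \<noteq> \<zero> \<and> z \<otimes> (a \<otimes> r) = \<zero>))"
  unfolding right_singular_ideal_eq singular_elements_def by auto

text \<open>
  Put \<open>a = 1 - z\<close>, choose a quasi-inverse \<open>b\<close>, and consider the idempotent \<open>t = 1 - ba\<close>.  If
  \<open>t \<noteq> 0\<close>, singularity of \<open>at = a - aba\<close> yields a nonzero \<open>y = tr\<close> with \<open>ay = 0\<close>, that is,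
  \<open>zy = y\<close>; but \<open>z\<close> is singular and annihilates some nonzero multiple of \<open>y\<close>.  Hence \<open>ba = 1\<close>, and
  since \<open>b\<close> is again of the form \<open>1 - z'\<close> with \<open>z'\<close> singular, it is invertible.
\<close>

lemma one_minus_singular_Units:
  assumes reg: "regular_modulo_singular R" and z: "z \<in> right_singular_ideal R"
  shows "\<one> \<ominus> z \<in> Units R"
proof -
  interpret Z: ideal "right_singular_ideal R" R by (rule right_singular_ideal_is_ideal)
  have left_inverse: "\<exists>b\<in>carrier R. b \<otimes> (\<one> \<ominus> z) = \<one>" if z: "z \<in> right_singular_ideal R" for z
  proof -
    have zR: "z \<in> carrier R" using z by (rule Z.Icarr)
    define a where "a = \<one> \<ominus> z"
    have a: "a \<in> carrier R" using zR by (simp add: a_def)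
    obtain b where b: "b \<in> carrier R" "b \<otimes> a \<otimes> b = b" "a \<ominus> a \<otimes> b \<otimes> a \<in> right_singular_ideal R"
      using reg a unfolding regular_modulo_singular_def by blast
    define t where "t = \<one> \<ominus> b \<otimes> a"
    have t: "t \<in> carrier R" using a b by (simp add: t_def)
    have "a \<otimes> t = a \<ominus> a \<otimes> b \<otimes> a" using a b(1) unfolding t_def by algebra
    then have at: "a \<otimes> t \<in> right_singular_ideal R" using b by simp
    have "b \<otimes> a \<otimes> (b \<otimes> a) = b \<otimes> a" using a b by (metis m_assoc m_closed)
    moreover have "t \<otimes> t = \<one> \<ominus> b \<otimes> a \<ominus> b \<otimes> a \<oplus> b \<otimes> a \<otimes> (b \<otimes> a)"
      using a b(1) unfolding t_def by algebra
    ultimately have "t \<otimes> t = \<one> \<ominus> b \<otimes> a \<ominus> b \<otimes> a \<oplus> b \<otimes> a" by simp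
    also have "\<dots> = t" using a b(1) unfolding t_def by algebra
    finally have tt: "t \<otimes> t = t" .
    have "t = \<zero>"
    proof (rule ccontr)
      assume "t \<noteq> \<zero>"
      then obtain r where r: "r \<in> carrier R" "t \<otimes> r \<noteq> \<zero>" "a \<otimes> t \<otimes> (t \<otimes> r) = \<zero>"
        using at t unfolding right_singular_ideal_iff by blast
      define y where "y = t \<otimes> r"
      have y: "y \<in> carrier R" "y \<noteq> \<zero>" using r t by (auto simp: y_def)
      have "a \<otimes> t \<otimes> (t \<otimes> r) = a \<otimes> (t \<otimes> t \<otimes> r)" using a t r(1) by (simp add: m_assoc)
      then have "a \<otimes> y = \<zero>" using r(3) tt by (simp add: y_def)
      moreover have "y = a \<otimes> y \<oplus> z \<otimes> y" using y(1) zR unfolding a_def by algebra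
      ultimately have zy: "z \<otimes> y = y" using y(1) zR by simp
      obtain s where s: "s \<in> carrier R" "y \<otimes> s \<noteq> \<zero>" "z \<otimes> (y \<otimes> s) = \<zero>"
        using z y unfolding right_singular_ideal_iff by blast
      have "z \<otimes> (y \<otimes> s) = y \<otimes> s" using zy y(1) s(1) zR by (metis m_assoc)
      then show False using s by simp
    qed
    then have "\<one> \<ominus> b \<otimes> a = \<zero>" by (simp add: t_def)
    moreover have "b \<otimes> a = \<one> \<ominus> (\<one> \<ominus> b \<otimes> a)" using a b(1) by algebra
    ultimately have "b \<otimes> a = \<one>" by (simp add: minus_eq)
    then show ?thesis using b(1) by (auto simp: a_def)
  qed
  have zR: "z \<in> carrier R" using z by (rule Z.Icarr)
  obtain b where b: "b \<in> carrier R" "b \<otimes> (\<one> \<ominus> z) = \<one>" using left_inverse[OF z] by blast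
  have "(\<ominus> b) \<otimes> z \<in> right_singular_ideal R" using b z by (auto intro: Z.I_l_closed)
  then obtain c where c: "c \<in> carrier R" "c \<otimes> (\<one> \<ominus> (\<ominus> b) \<otimes> z) = \<one>" using left_inverse by blast
  have "b = b \<otimes> (\<one> \<ominus> z) \<oplus> b \<otimes> z" using zR b(1) by algebra
  then have "b = \<one> \<oplus> b \<otimes> z" using b(2) by simp
  also have "\<dots> = \<one> \<ominus> (\<ominus> b) \<otimes> z" using zR b(1) by algebra
  finally have "c \<otimes> b = \<one>" using c by simp
  then have "c = \<one> \<ominus> z"
    using b c zR by (metis l_one m_assoc minus_closed one_closed r_one)
  then show ?thesis using \<open>c \<otimes> b = \<one>\<close> b c zR unfolding Units_def by auto
qed

text \<open>
  A singular \<open>z\<close> outside a maximal right ideal \<open>I\<close> would give \<open>1 = i + zr\<close> with \<open>i \<in> I\<close>, while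
  \<open>1 - zr\<close> is a unit.  Conversely, for \<open>a\<close> in the radical, \<open>(1 - ab)a\<close> is singular for some \<open>b\<close>, and
  \<open>1 - ab\<close> is a unit.
\<close>

lemma jacobson_radical_eq_right_singular_ideal:
  assumes reg: "regular_modulo_singular R"
  shows "jacobson_radical R = right_singular_ideal R"
proof
  interpret Z: ideal "right_singular_ideal R" R by (rule right_singular_ideal_is_ideal)
  show "right_singular_ideal R \<subseteq> jacobson_radical R"
  proof
    fix z assume z: "z \<in> right_singular_ideal R"
    then have zR: "z \<in> carrier R" by (rule Z.Icarr)
    have "z \<in> I" if I: "maximal_right_ideal I R" for I
    proof (rule ccontr)
      assume "z \<notin> I"
      note ID = I[unfolded maximal_right_ideal_def right_ideal_iff]
      have Isub: "i \<in> carrier R" if "i \<in> I" for i using that ID by auto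
      have I0: "\<zero> \<in> I" using ID by simp
      have Iadd: "i \<oplus> j \<in> I" if "i \<in> I" "j \<in> I" for i j using that ID by simp
      have Imult: "i \<otimes> r \<in> I" if "i \<in> I" "r \<in> carrier R" for i r using that ID by simp
      define K where "K = {i \<oplus> z \<otimes> r | i r. i \<in> I \<and> r \<in> carrier R}"
      have KI: "x \<in> K" if "x = i \<oplus> z \<otimes> r" "i \<in> I" "r \<in> carrier R" for x i r
        using that unfolding K_def by blast
      have K: "right_ideal K R" unfolding right_ideal_iff
      proof (intro conjI ballI)
        show "K \<subseteq> carrier R" using Isub zR unfolding K_def by auto
        have "\<zero> = \<zero> \<oplus> z \<otimes> \<zero>" using zR by simp
        then show "\<zero> \<in> K" by (rule KI[OF _ I0 zero_closed])
      next
        fix x y assume "x \<in> K" "y \<in> K"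
        then obtain i r j s where *: "x = i \<oplus> z \<otimes> r" "y = j \<oplus> z \<otimes> s" "i \<in> I" "j \<in> I"
          "r \<in> carrier R" "s \<in> carrier R" unfolding K_def by auto
        then have "x \<oplus> y = (i \<oplus> j) \<oplus> z \<otimes> (r \<oplus> s)"
          using Isub[of i] Isub[of j] zR by (simp add: r_distr a_ac)
        then show "x \<oplus> y \<in> K" by (rule KI) (use * Iadd in auto)
      next
        fix a x assume a: "a \<in> carrier R" "x \<in> K"
        then obtain i r where *: "x = i \<oplus> z \<otimes> r" "i \<in> I" "r \<in> carrier R" unfolding K_def by auto
        then have "x \<otimes> a = i \<otimes> a \<oplus> z \<otimes> (r \<otimes> a)"
          using Isub[of i] zR a by (simp add: l_distr m_assoc)
        then show "x \<otimes> a \<in> K" by (rule KI) (use * Imult a in auto)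
      qed
      have IK: "i \<in> K" if "i \<in> I" for i
      proof -
        have "i = i \<oplus> z \<otimes> \<zero>" using Isub[OF that] zR by simp
        then show ?thesis by (rule KI[OF _ that zero_closed])
      qed
      have zK: "z \<in> K"
      proof -
        have "z = \<zero> \<oplus> z \<otimes> \<one>" using zR by simp
        then show ?thesis by (rule KI[OF _ I0 one_closed])
      qed
      have "K = I \<or> K = carrier R"
        using I K IK unfolding maximal_right_ideal_def by (simp add: subsetI)
      then have "\<one> \<in> K" using zK \<open>z \<notin> I\<close> by auto
      then obtain i r where ir: "i \<in> I" "r \<in> carrier R" "\<one> = i \<oplus> z \<otimes> r"
        unfolding K_def by blast
      have "i = (i \<oplus> z \<otimes> r) \<ominus> z \<otimes> r" using ir(2) Isub[OF ir(1)] zR by algebra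
      then have "i = \<one> \<ominus> z \<otimes> r" using ir(3) by simp
      then have "i \<in> Units R"
        using one_minus_singular_Units[OF reg] Z.I_r_closed[OF z ir(2)] by simp
      then have "i \<otimes> (inv i \<otimes> x) = x" if "x \<in> carrier R" for x
        using that by (simp add: Units_closed flip: m_assoc)
      then have "x \<in> I" if "x \<in> carrier R" for x
        using Imult[OF ir(1), of "inv i \<otimes> x"] \<open>i \<in> Units R\<close> that by simp
      then show False using ID by auto
    qed
    then show "z \<in> jacobson_radical R" using zR by (simp add: jacobson_radical_def)
  qed
  show "jacobson_radical R \<subseteq> right_singular_ideal R"
  proof
    fix a assume aJ: "a \<in> jacobson_radical R"
    note J = jacobson_radical_right_ideal[unfolded right_ideal_iff]
    have a: "a \<in> carrier R" using aJ J by auto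
    obtain b where b: "b \<in> carrier R" "a \<ominus> a \<otimes> b \<otimes> a \<in> right_singular_ideal R"
      using reg a unfolding regular_modulo_singular_def by blast
    have u: "\<one> \<ominus> a \<otimes> b \<in> Units R" using J aJ b by (intro one_minus_jacobson_radical_Units) auto
    have "(\<one> \<ominus> a \<otimes> b) \<otimes> a = a \<ominus> a \<otimes> b \<otimes> a" using a b(1) by algebra
    then have "inv (\<one> \<ominus> a \<otimes> b) \<otimes> ((\<one> \<ominus> a \<otimes> b) \<otimes> a) \<in> right_singular_ideal R"
      using b u by (auto intro: Z.I_l_closed)
    moreover have "inv (\<one> \<ominus> a \<otimes> b) \<otimes> ((\<one> \<ominus> a \<otimes> b) \<otimes> a) = a"
      using u a by (simp add: Units_closed flip: m_assoc)
    ultimately show "a \<in> right_singular_ideal R" by simp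
  qed
qed

text \<open>
  Let \<open>x\<close> be idempotent modulo the ideal, let \<open>b\<close> be a quasi-inverse of \<open>x\<close>, and put \<open>e = xb\<close>, which
  is an honest idempotent.  In the quotient \<open>ex = x\<close> and \<open>xe = e\<close>, so the idempotent
  \<open>g = e + ex(1 - e)\<close> becomes \<open>e + x - xe = x\<close> there.
\<close>

lemma semiregular_if_regular_modulo_singular:
  assumes reg: "regular_modulo_singular R"
  shows "semiregular R"
proof -
  let ?Z = "right_singular_ideal R"
  note Z = right_singular_ideal_is_ideal
  interpret Z: ideal ?Z R by (rule Z)
  let ?Q = "R Quot ?Z"
  interpret Q: ring_hom_ring R ?Q "(+>) ?Z" by (rule Z.rcos_ring_hom_ring)
  have eq_iff: "?Z +> x = ?Z +> y \<longleftrightarrow> x \<ominus> y \<in> ?Z" if "x \<in> carrier R" "y \<in> carrier R" for x y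
    using a_coset_eq_iff[OF Z that] .
  have quasi: "\<exists>b\<in>carrier R. b \<otimes> a \<otimes> b = b \<and> ?Z +> (a \<otimes> b \<otimes> a) = ?Z +> a"
    if a: "a \<in> carrier R" for a
  proof -
    obtain b where b: "b \<in> carrier R" "b \<otimes> a \<otimes> b = b" "a \<ominus> a \<otimes> b \<otimes> a \<in> ?Z"
      using reg a unfolding regular_modulo_singular_def by blast
    then have "?Z +> a = ?Z +> (a \<otimes> b \<otimes> a)" using a by (subst eq_iff) auto
    with b show ?thesis by auto
  qed
  have "von_neumann_regular ?Q"
    using quasi unfolding von_neumann_regular_Quot_iff[OF Z] by blast
  moreover have "idempotents_lift_modulo ?Z R"
    unfolding idempotents_lift_modulo_def
  proof (intro ballI impI)
    fix x assume x: "x \<in> carrier R" "x \<otimes> x \<ominus> x \<in> ?Z"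
    obtain b where b: "b \<in> carrier R" "b \<otimes> x \<otimes> b = b" "?Z +> (x \<otimes> b \<otimes> x) = ?Z +> x"
      using quasi x(1) by blast
    define e where "e = x \<otimes> b"
    have e: "e \<in> carrier R" "e \<otimes> e = e"
      using x b by (auto simp: e_def m_assoc)
    define g where "g = e \<oplus> e \<otimes> x \<otimes> (\<one> \<ominus> e)"
    have g: "g \<in> carrier R" using e x by (simp add: g_def)
    have comp: "(\<one> \<ominus> e) \<otimes> e = \<zero>"
    proof -
      have "(\<one> \<ominus> e) \<otimes> e = e \<ominus> e \<otimes> e" using e(1) by algebra
      then show ?thesis using e by (simp add: minus_eq r_neg)
    qed
    have "g \<otimes> g = e \<otimes> e \<oplus> e \<otimes> e \<otimes> x \<otimes> (\<one> \<ominus> e) \<oplus> e \<otimes> x \<otimes> ((\<one> \<ominus> e) \<otimes> e)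
        \<oplus> e \<otimes> x \<otimes> ((\<one> \<ominus> e) \<otimes> e) \<otimes> x \<otimes> (\<one> \<ominus> e)"
      using e(1) x(1) by (simp add: g_def l_distr r_distr m_assoc a_ac)
    also have "\<dots> = g" using comp e x(1) by (simp add: g_def)
    finally have "g \<otimes> g = g" .
    moreover have "?Z +> g = ?Z +> x"
    proof -
      let ?h = "(+>) ?Z"
      have xx: "?h x \<otimes>\<^bsub>?Q\<^esub> ?h x = ?h x"
        using x eq_iff[of "x \<otimes> x" x] by (simp flip: Q.hom_mult)
      have ex: "?h e \<otimes>\<^bsub>?Q\<^esub> ?h x = ?h x"
        using b x by (simp add: e_def flip: Q.hom_mult)
      have xe: "?h x \<otimes>\<^bsub>?Q\<^esub> ?h e = ?h e"
        using xx x b(1) by (simp add: e_def flip: Q.S.m_assoc)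
      have hx: "?h x \<in> carrier ?Q" and he: "?h e \<in> carrier ?Q" using x e by auto
      have "?h g = ?h e \<oplus>\<^bsub>?Q\<^esub> ?h e \<otimes>\<^bsub>?Q\<^esub> ?h x \<otimes>\<^bsub>?Q\<^esub> (\<one>\<^bsub>?Q\<^esub> \<ominus>\<^bsub>?Q\<^esub> ?h e)"
        using e x by (simp add: g_def minus_eq Q.S.minus_eq)
      also have "\<dots> = ?h e \<oplus>\<^bsub>?Q\<^esub> (?h x \<ominus>\<^bsub>?Q\<^esub> ?h x \<otimes>\<^bsub>?Q\<^esub> ?h e)"
        using hx he ex by (simp add: Q.S.minus_eq Q.S.r_distr Q.S.r_minus)
      also have "\<dots> = ?h e \<oplus>\<^bsub>?Q\<^esub> (?h x \<ominus>\<^bsub>?Q\<^esub> ?h e)" by (simp add: xe)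
      also have "\<dots> = ?h x" using hx he by algebra
      finally show ?thesis .
    qed
    ultimately show "\<exists>e\<in>carrier R. e \<otimes> e = e \<and> e \<ominus> x \<in> ?Z"
      using g x(1) eq_iff by blast
  qed
  ultimately show ?thesis
    unfolding semiregular_def jacobson_radical_eq_right_singular_ideal[OF reg] by blast
qed

text \<open>
  Let \<open>aba\<close> be congruent to \<open>a\<close> modulo the radical, and lift the idempotent class of \<open>ab\<close> to an
  idempotent \<open>e\<close>.  Then \<open>u = 1 - (e - ab)\<close> is a unit congruent to \<open>1\<close> and \<open>eu = eab\<close>, so
  \<open>c = bve\<close>, where \<open>v\<close> is the inverse of \<open>u\<close>, satisfies \<open>cac = bv(eab)ve = c\<close>, and \<open>aca\<close> is congruent to \<open>a\<close>.
\<close>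

lemma regular_modulo_singular_if_semiregular:
  assumes semi: "semiregular R" and JZ: "jacobson_radical R = right_singular_ideal R"
  shows "regular_modulo_singular R"
  unfolding regular_modulo_singular_def
proof
  let ?Z = "right_singular_ideal R"
  note Z = right_singular_ideal_is_ideal
  interpret Z: ideal ?Z R by (rule Z)
  let ?Q = "R Quot ?Z" and ?h = "(+>) ?Z"
  interpret Q: ring_hom_ring R ?Q ?h by (rule Z.rcos_ring_hom_ring)
  have eq_iff: "?h x = ?h y \<longleftrightarrow> x \<ominus> y \<in> ?Z" if "x \<in> carrier R" "y \<in> carrier R" for x y
    using a_coset_eq_iff[OF Z that] .
  fix a assume a: "a \<in> carrier R"
  obtain b where b: "b \<in> carrier R" "?h (a \<otimes> b \<otimes> a) = ?h a"
    using semi a unfolding semiregular_def JZ von_neumann_regular_Quot_iff[OF Z] by blast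
  have aba: "?h a \<otimes>\<^bsub>?Q\<^esub> ?h b \<otimes>\<^bsub>?Q\<^esub> ?h a = ?h a" using a b by simp
  have "?h (a \<otimes> b \<otimes> (a \<otimes> b)) = ?h (a \<otimes> b)"
    using a b(1) aba by (simp flip: Q.S.m_assoc)
  then have "a \<otimes> b \<otimes> (a \<otimes> b) \<ominus> a \<otimes> b \<in> ?Z" using a b(1) by (subst (asm) eq_iff) auto
  then obtain e where e: "e \<in> carrier R" "e \<otimes> e = e" "e \<ominus> a \<otimes> b \<in> ?Z"
    using semi a b(1) unfolding semiregular_def JZ idempotents_lift_modulo_def by blast
  have he: "?h e = ?h a \<otimes>\<^bsub>?Q\<^esub> ?h b" using e a b(1) eq_iff[of e "a \<otimes> b"] by simp
  define u where "u = \<one> \<ominus> (e \<ominus> a \<otimes> b)"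
  have u: "u \<in> Units R" using one_minus_jacobson_radical_Units e(3) JZ by (simp add: u_def)
  then have uR: "u \<in> carrier R" "inv u \<in> carrier R" "u \<otimes> inv u = \<one>" "inv u \<otimes> u = \<one>" by auto
  have "?h (\<one> \<ominus> u) = ?h \<zero>"
  proof -
    have "\<one> \<ominus> u \<ominus> \<zero> = e \<ominus> a \<otimes> b" using e(1) a b(1) unfolding u_def by algebra
    then show ?thesis using e(3) uR by (subst eq_iff) auto
  qed
  moreover have "u = \<one> \<ominus> (\<one> \<ominus> u)" using uR(1) by algebra
  ultimately have hu: "?h u = \<one>\<^bsub>?Q\<^esub>"
    using uR(1) by (metis Q.hom_one Z.a_Hcarr eq_iff minus_closed one_closed r_zero minus_eq minus_zero zero_closed)
  have hv: "?h (inv u) = \<one>\<^bsub>?Q\<^esub>"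
  proof -
    have "?h u \<otimes>\<^bsub>?Q\<^esub> ?h (inv u) = \<one>\<^bsub>?Q\<^esub>" using uR by (simp flip: Q.hom_mult)
    then show ?thesis using uR(2) hu by simp
  qed
  have "e \<otimes> u = e \<otimes> a \<otimes> b"
  proof -
    have "e \<otimes> u = e \<ominus> e \<otimes> e \<oplus> e \<otimes> a \<otimes> b" using e(1) a b(1) unfolding u_def by algebra
    then show ?thesis using e a b(1) by (simp add: minus_eq r_neg)
  qed
  define c where "c = b \<otimes> inv u \<otimes> e"
  have c: "c \<in> carrier R" using b uR e by (simp add: c_def)
  have "c \<otimes> a \<otimes> c = b \<otimes> inv u \<otimes> (e \<otimes> a \<otimes> b) \<otimes> inv u \<otimes> e"
    using a b(1) e(1) uR by (simp add: c_def m_assoc)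
  also have "\<dots> = b \<otimes> inv u \<otimes> (e \<otimes> (u \<otimes> inv u) \<otimes> e)"
    using b(1) e(1) uR(1,2) unfolding \<open>e \<otimes> u = e \<otimes> a \<otimes> b\<close>[symmetric] by (simp add: m_assoc)
  also have "\<dots> = c" using b(1) e uR by (simp add: c_def)
  finally have "c \<otimes> a \<otimes> c = c" .
  moreover have "?h (a \<otimes> c \<otimes> a) = ?h a"
  proof -
    have "?h (a \<otimes> c \<otimes> a) = ?h a \<otimes>\<^bsub>?Q\<^esub> ?h b \<otimes>\<^bsub>?Q\<^esub> (?h a \<otimes>\<^bsub>?Q\<^esub> ?h b \<otimes>\<^bsub>?Q\<^esub> ?h a)"
      using a b(1) e(1) uR by (simp add: c_def hv he Q.S.m_assoc)
    also have "\<dots> = ?h a" by (simp add: aba)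
    finally show ?thesis .
  qed
  then have "a \<ominus> a \<otimes> c \<otimes> a \<in> ?Z" using a c by (subst eq_iff[symmetric]) auto
  ultimately show "\<exists>b\<in>carrier R. b \<otimes> a \<otimes> b = b \<and> a \<ominus> a \<otimes> b \<otimes> a \<in> ?Z" using c by blast
qed

end

section \<open>From the ring to modules with a finite dual basis\<close>

text \<open>
  For a dual basis in the usual sense, \<open>x\<close> is the sum of the elements \<open>m\<^sub>t f\<^sub>t(x)\<close>.  The proofs below
  only use that \<open>x\<close> lies in the submodule generated by these elements, and the definition asks for
  just this, so that no finite sums have to be manipulated.
\<close>

definition finite_dual_basis ::
  "('a, 'b) ring_scheme \<Rightarrow> ('a, 'm) module \<Rightarrow> 't set \<Rightarrow> ('t \<Rightarrow> 'm) \<Rightarrow> ('t \<Rightarrow> 'm \<Rightarrow> 'a) \<Rightarrow> bool"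
  where "finite_dual_basis R M T m f \<longleftrightarrow> finite T \<and>
    (\<forall>t\<in>T. m t \<in> carrier M \<and> f t \<in> rmod_hom R M (right_regular_module R)) \<and>
    (\<forall>x\<in>carrier M. \<forall>N. submodule N R M \<longrightarrow> (\<forall>t\<in>T. f t x \<odot>\<^bsub>M\<^esub> m t \<in> N) \<longrightarrow> x \<in> N)"

lemma finite_dual_basis_separating:
  assumes M: "right_module R M" and dual: "finite_dual_basis R M T m f"
    and x: "x \<in> carrier M" "\<And>t. t \<in> T \<Longrightarrow> f t x = \<zero>\<^bsub>R\<^esub>"
  shows "x = \<zero>\<^bsub>M\<^esub>"
proof -
  interpret M: right_module R M by (rule M)
  have "submodule {\<zero>\<^bsub>M\<^esub>} R M" by (auto simp: M.submodule_iff)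
  moreover have "\<forall>t\<in>T. f t x \<odot>\<^bsub>M\<^esub> m t \<in> {\<zero>\<^bsub>M\<^esub>}"
    using dual x(2) unfolding finite_dual_basis_def by auto
  ultimately have "x \<in> {\<zero>\<^bsub>M\<^esub>}" using dual x(1) unfolding finite_dual_basis_def by blast
  then show ?thesis by simp
qed

context ring
begin

lemma functional_rules:
  assumes "right_module R N" "f \<in> rmod_hom R N (right_regular_module R)"
  shows "\<And>x. x \<in> carrier N \<Longrightarrow> f x \<in> carrier R"
    "\<And>x y. x \<in> carrier N \<Longrightarrow> y \<in> carrier N \<Longrightarrow> f (x \<oplus>\<^bsub>N\<^esub> y) = f x \<oplus> f y"
    "\<And>x y. x \<in> carrier N \<Longrightarrow> y \<in> carrier N \<Longrightarrow> f (x \<ominus>\<^bsub>N\<^esub> y) = f x \<ominus> f y"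
    "\<And>a x. a \<in> carrier R \<Longrightarrow> x \<in> carrier N \<Longrightarrow> f (a \<odot>\<^bsub>N\<^esub> x) = f x \<otimes> a"
    "f \<zero>\<^bsub>N\<^esub> = \<zero>"
  using rmod_homD[OF assms(2)] rmod_hom_diff[OF assms(1) right_regular_module assms(2)]
    rmod_hom_zero[OF assms(1) right_regular_module assms(2)] by simp_all

text \<open>
  A functional \<open>h\<close> is built with \<open>h(y)h = h\<close> that is a quasi-inverse of \<open>y\<close>, seen as the map
  \<open>R \<rightarrow> N\<close> sending \<open>a\<close> to \<open>ya\<close>, as far as finitely many coordinates \<open>f\<^sub>t\<close> can tell.  This is
  elimination, one coordinate \<open>f\<close> at a time.  With \<open>g = h(y)\<close>, the part of \<open>f(y)\<close> not yet treated is
  \<open>r = f(y)(1 - g)\<close>.  Take a quasi-inverse \<open>d\<^sub>0\<close> of \<open>r\<close> in the ring, replace it by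
  \<open>d = (1 - g)d\<^sub>0\<close> so that \<open>gd = 0\<close>, and correct \<open>h\<close> to \<open>h'(x) = h(x) + d f(x - y h(x))\<close>.  The
  earlier coordinates are only multiplied by \<open>1 - dr\<close> on the right and stay singular.
\<close>

lemma functional_quasi_inverse_coordinates:
  assumes reg: "regular_modulo_singular R" and N: "right_module R N" and y: "y \<in> carrier N"
    and "finite T" and f: "\<And>t. t \<in> T \<Longrightarrow> f t \<in> rmod_hom R N (right_regular_module R)"
  shows "\<exists>h\<in>rmod_hom R N (right_regular_module R).
    (\<forall>x\<in>carrier N. h y \<otimes> h x = h x) \<and>
    (\<forall>t\<in>T. f t (y \<ominus>\<^bsub>N\<^esub> h y \<odot>\<^bsub>N\<^esub> y) \<in> right_singular_ideal R)"
  using \<open>finite T\<close> f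
proof (induction T)
  case empty
  have "(\<lambda>x. \<zero>) \<in> rmod_hom R N (right_regular_module R)" by (rule rmod_homI) auto
  then show ?case by (rule bexI[rotated]) auto
next
  case (insert s T)
  interpret N: right_module R N by (rule N)
  let ?S = "right_regular_module R" and ?Z = "right_singular_ideal R"
  interpret Z: ideal ?Z R by (rule right_singular_ideal_is_ideal)
  obtain h where h: "h \<in> rmod_hom R N ?S" and hy: "\<forall>x\<in>carrier N. h y \<otimes> h x = h x"
    and hT: "\<forall>t\<in>T. f t (y \<ominus>\<^bsub>N\<^esub> h y \<odot>\<^bsub>N\<^esub> y) \<in> ?Z"
    using insert by auto
  have F: "f s \<in> rmod_hom R N ?S" using insert by simp
  note hD = functional_rules[OF N h] and FD = functional_rules[OF N F]
  define g where "g = h y"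
  define \<rho> where "\<rho> = f s y"
  define r where "r = \<rho> \<ominus> \<rho> \<otimes> g"
  have g: "g \<in> carrier R" and \<rho>: "\<rho> \<in> carrier R" using hD FD y by (auto simp: g_def \<rho>_def)
  then have r: "r \<in> carrier R" by (simp add: r_def)
  have gh: "g \<otimes> h x = h x" if "x \<in> carrier N" for x using hy that by (simp add: g_def)
  have gg: "g \<otimes> g = g" using gh[OF y] by (simp add: g_def)
  have rh: "r \<otimes> h x = \<zero>" if x: "x \<in> carrier N" for x
  proof -
    have "r \<otimes> h x = \<rho> \<otimes> h x \<ominus> \<rho> \<otimes> (g \<otimes> h x)"
      using g \<rho> hD(1)[OF x] unfolding r_def by algebra
    then show ?thesis using gh[OF x] \<rho> hD(1)[OF x] by (simp add: minus_eq r_neg)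
  qed
  then have rg: "r \<otimes> g = \<zero>" using y by (simp add: g_def)
  obtain d\<^sub>0 where d\<^sub>0: "d\<^sub>0 \<in> carrier R" "d\<^sub>0 \<otimes> r \<otimes> d\<^sub>0 = d\<^sub>0" "r \<ominus> r \<otimes> d\<^sub>0 \<otimes> r \<in> ?Z"
    using reg r unfolding regular_modulo_singular_def by blast
  define d where "d = d\<^sub>0 \<ominus> g \<otimes> d\<^sub>0"
  have d: "d \<in> carrier R" using d\<^sub>0 g by (simp add: d_def)
  have gd: "g \<otimes> d = \<zero>"
  proof -
    have "g \<otimes> d = g \<otimes> d\<^sub>0 \<ominus> g \<otimes> g \<otimes> d\<^sub>0" using g d\<^sub>0(1) unfolding d_def by algebra
    then show ?thesis using gg g d\<^sub>0(1) by (simp add: minus_eq r_neg)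
  qed
  have rd: "r \<otimes> d = r \<otimes> d\<^sub>0"
  proof -
    have "r \<otimes> d = r \<otimes> d\<^sub>0 \<ominus> r \<otimes> g \<otimes> d\<^sub>0" using g r d\<^sub>0(1) unfolding d_def by algebra
    then show ?thesis using rg r d\<^sub>0(1) by (simp add: minus_eq)
  qed
  have drd: "d \<otimes> r \<otimes> d = d"
  proof -
    have "d \<otimes> r \<otimes> d = (d\<^sub>0 \<ominus> g \<otimes> d\<^sub>0) \<otimes> (r \<otimes> d\<^sub>0)"
      using r d d\<^sub>0(1) rd by (simp add: d_def[symmetric] m_assoc)
    also have "\<dots> = d\<^sub>0 \<otimes> r \<otimes> d\<^sub>0 \<ominus> g \<otimes> (d\<^sub>0 \<otimes> r \<otimes> d\<^sub>0)" using g r d\<^sub>0(1) by algebra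
    finally show ?thesis by (simp add: d\<^sub>0 d_def)
  qed
  have \<rho>d: "\<rho> \<otimes> d = r \<otimes> d\<^sub>0"
  proof -
    have "r \<otimes> d = \<rho> \<otimes> d \<ominus> \<rho> \<otimes> (g \<otimes> d)" using g \<rho> d unfolding r_def by algebra
    then show ?thesis using gd \<rho> d rd by (simp add: minus_eq)
  qed
  define w where "w x = f s x \<ominus> \<rho> \<otimes> h x" for x
  have wR: "w x \<in> carrier R" if "x \<in> carrier N" for x using that FD hD \<rho> by (simp add: w_def)
  define h' where "h' x = h x \<oplus> d \<otimes> w x" for x
  have h': "h' \<in> rmod_hom R N ?S"
  proof (rule rmod_homI)
    fix x assume "x \<in> carrier N"
    then show "h' x \<in> carrier ?S" using hD wR d by (simp add: h'_def)
  next
    fix x z assume xz: "x \<in> carrier N" "z \<in> carrier N"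
    then have "f s x \<in> carrier R" "f s z \<in> carrier R" "h x \<in> carrier R" "h z \<in> carrier R"
      using FD hD by auto
    then have "h x \<oplus> h z \<oplus> d \<otimes> (f s x \<oplus> f s z \<ominus> \<rho> \<otimes> (h x \<oplus> h z)) =
        (h x \<oplus> d \<otimes> (f s x \<ominus> \<rho> \<otimes> h x)) \<oplus> (h z \<oplus> d \<otimes> (f s z \<ominus> \<rho> \<otimes> h z))"
      using \<rho> d by algebra
    then show "h' (x \<oplus>\<^bsub>N\<^esub> z) = h' x \<oplus>\<^bsub>?S\<^esub> h' z"
      using xz by (simp add: h'_def w_def hD FD)
  next
    fix a x assume ax: "a \<in> carrier R" "x \<in> carrier N"
    then have "f s x \<in> carrier R" "h x \<in> carrier R" using FD hD by auto
    then have "h x \<otimes> a \<oplus> d \<otimes> (f s x \<otimes> a \<ominus> \<rho> \<otimes> (h x \<otimes> a)) =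
        (h x \<oplus> d \<otimes> (f s x \<ominus> \<rho> \<otimes> h x)) \<otimes> a"
      using \<rho> d ax(1) by algebra
    then show "h' (a \<odot>\<^bsub>N\<^esub> x) = a \<odot>\<^bsub>?S\<^esub> h' x"
      using ax by (simp add: h'_def w_def hD FD)
  qed
  have h'y: "h' y = g \<oplus> d \<otimes> r" by (simp add: h'_def w_def g_def \<rho>_def r_def)
  have "h' y \<otimes> h' x = h' x" if x: "x \<in> carrier N" for x
  proof -
    have "h' y \<otimes> h' x = g \<otimes> h x \<oplus> g \<otimes> d \<otimes> w x \<oplus> d \<otimes> (r \<otimes> h x) \<oplus> d \<otimes> r \<otimes> d \<otimes> w x"
      using g d r hD(1)[OF x] wR[OF x] unfolding h'y unfolding h'_def by algebra
    then show ?thesis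
      using gh[OF x] gd rh[OF x] drd d hD(1)[OF x] wR[OF x] by (simp add: h'_def)
  qed
  moreover have "f t (y \<ominus>\<^bsub>N\<^esub> h' y \<odot>\<^bsub>N\<^esub> y) \<in> ?Z" if t: "t \<in> insert s T" for t
  proof -
    have ft: "f t \<in> rmod_hom R N ?S" using insert t by simp
    note ftD = functional_rules[OF N ft]
    have h'yR: "h' y \<in> carrier R" using g d r by (simp add: h'y)
    have red: "f t (y \<ominus>\<^bsub>N\<^esub> h' y \<odot>\<^bsub>N\<^esub> y) = f t y \<ominus> f t y \<otimes> h' y"
      using h'yR y by (simp add: ftD)
    show ?thesis
    proof (cases "t = s")
      case True
      have "\<rho> \<ominus> \<rho> \<otimes> h' y = r \<ominus> \<rho> \<otimes> d \<otimes> r"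
        using g d r \<rho> unfolding h'y by (simp add: r_distr minus_eq minus_add m_assoc r_def a_ac)
      then show ?thesis using True red \<rho>d d\<^sub>0 by (simp add: \<rho>_def)
    next
      case False
      then have "f t (y \<ominus>\<^bsub>N\<^esub> g \<odot>\<^bsub>N\<^esub> y) \<in> ?Z" using hT t by (simp add: g_def)
      then have \<tau>: "f t y \<ominus> f t y \<otimes> g \<in> ?Z" using g y by (simp add: ftD)
      have "(f t y \<ominus> f t y \<otimes> g) \<otimes> (\<one> \<ominus> d \<otimes> r) =
          f t y \<ominus> f t y \<otimes> (g \<oplus> d \<otimes> r) \<oplus> f t y \<otimes> (g \<otimes> d) \<otimes> r"
        using ftD(1)[OF y] g d r by algebra
      also have "\<dots> = f t y \<ominus> f t y \<otimes> h' y"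
        using gd ftD(1)[OF y] g d r by (simp add: h'y)
      finally show ?thesis using red Z.I_r_closed[OF \<tau>, of "\<one> \<ominus> d \<otimes> r"] d r by simp
    qed
  qed
  ultimately show ?case using h' by blast
qed

text \<open>
  A finite intersection of essential right ideals is essential.
\<close>

lemma common_annihilator_of_singular:
  assumes "finite T" and "\<And>t. t \<in> T \<Longrightarrow> z t \<in> right_singular_ideal R"
    and "a \<in> carrier R" "a \<noteq> \<zero>"
  shows "\<exists>r\<in>carrier R. a \<otimes> r \<noteq> \<zero> \<and> (\<forall>t\<in>T. z t \<otimes> (a \<otimes> r) = \<zero>)"
  using assms(1,2)
proof (induction T)
  case empty
  then show ?case using assms(3,4) by (intro bexI[of _ \<one>]) auto
next
  case (insert s T)
  then obtain r where r: "r \<in> carrier R" "a \<otimes> r \<noteq> \<zero>" "\<forall>t\<in>T. z t \<otimes> (a \<otimes> r) = \<zero>" by auto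
  have zR: "z t \<in> carrier R" if "t \<in> insert s T" for t
    using insert.prems that by (auto simp: right_singular_ideal_iff)
  have "z s \<in> right_singular_ideal R" using insert.prems by simp
  then obtain q where q: "q \<in> carrier R" "a \<otimes> r \<otimes> q \<noteq> \<zero>" "z s \<otimes> (a \<otimes> r \<otimes> q) = \<zero>"
    using r(1,2) assms(3) unfolding right_singular_ideal_iff by (meson m_closed)
  have "z t \<otimes> (a \<otimes> r \<otimes> q) = \<zero>" if "t \<in> T" for t
  proof -
    have "z t \<otimes> (a \<otimes> r \<otimes> q) = z t \<otimes> (a \<otimes> r) \<otimes> q"
      using zR that r(1) q(1) assms(3) by (simp add: m_assoc)
    then show ?thesis using r(3) that q(1) by simp
  qed
  then show ?case using r(1) q assms(3) by (intro bexI[of _ "r \<otimes> q"]) (auto simp: m_assoc)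
qed

text \<open>
  An element with finitely many coordinates, all singular, is singular, because the coordinates
  separate points.
\<close>

lemma functional_quasi_inverse:
  assumes reg: "regular_modulo_singular R" and N: "right_module R N"
    and dual: "finite_dual_basis R N T m f" and y: "y \<in> carrier N"
  shows "\<exists>h\<in>rmod_hom R N (right_regular_module R).
    (\<forall>x\<in>carrier N. h y \<otimes> h x = h x) \<and> y \<ominus>\<^bsub>N\<^esub> h y \<odot>\<^bsub>N\<^esub> y \<in> singular_elements R N"
proof -
  interpret N: right_module R N by (rule N)
  have T: "finite T" and f: "\<And>t. t \<in> T \<Longrightarrow> f t \<in> rmod_hom R N (right_regular_module R)"
    using dual by (auto simp: finite_dual_basis_def)
  obtain h where h: "h \<in> rmod_hom R N (right_regular_module R)"
    and hy: "\<forall>x\<in>carrier N. h y \<otimes> h x = h x"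
    and hT: "\<forall>t\<in>T. f t (y \<ominus>\<^bsub>N\<^esub> h y \<odot>\<^bsub>N\<^esub> y) \<in> right_singular_ideal R"
    using functional_quasi_inverse_coordinates[where f = f, OF reg N y T f] by blast
  define z where "z = y \<ominus>\<^bsub>N\<^esub> h y \<odot>\<^bsub>N\<^esub> y"
  have z: "z \<in> carrier N" using y functional_rules(1)[OF N h y] by (simp add: z_def)
  have "\<exists>r\<in>carrier R. a \<otimes> r \<noteq> \<zero> \<and> (a \<otimes> r) \<odot>\<^bsub>N\<^esub> z = \<zero>\<^bsub>N\<^esub>" if a: "a \<in> carrier R" "a \<noteq> \<zero>" for a
  proof -
    obtain r where r: "r \<in> carrier R" "a \<otimes> r \<noteq> \<zero>" "\<forall>t\<in>T. f t z \<otimes> (a \<otimes> r) = \<zero>"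
      using common_annihilator_of_singular[of T "\<lambda>t. f t z" a] T hT a by (auto simp: z_def)
    have "f t ((a \<otimes> r) \<odot>\<^bsub>N\<^esub> z) = \<zero>" if "t \<in> T" for t
      using functional_rules(4)[OF N f[OF that], of "a \<otimes> r" z] r a z that by simp
    then have "(a \<otimes> r) \<odot>\<^bsub>N\<^esub> z = \<zero>\<^bsub>N\<^esub>"
      using finite_dual_basis_separating[OF N dual] a r z by auto
    then show ?thesis using r by auto
  qed
  then have "z \<in> singular_elements R N" using z unfolding singular_elements_def by auto
  then show ?thesis using h hy by (auto simp: z_def)
qed

text \<open>
  The same elimination on the source side.  Suppose that \<open>\<psi>\<close> is a quasi-inverse of \<open>\<phi>\<close> as far as
  \<open>m\<^sub>t\<close>, \<open>t \<in> T\<close>, are concerned, let \<open>e = \<phi>\<psi>\<close>, and let \<open>y = \<phi>(m\<^sub>s)\<close> be one more value.  A functional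
  \<open>h\<close> that is a quasi-inverse of \<open>y' = y - e(y)\<close> is replaced by \<open>h' = h(1 - e)\<close>, which kills the
  image of \<open>e\<close>.  The new map is \<open>\<psi>'(x) = \<psi>(x - y h'(x)) + m\<^sub>s h'(x)\<close>; it satisfies
  \<open>\<phi>\<psi>' = e + y'h'\<close>, a sum of two orthogonal idempotents.
\<close>

lemma quasi_inverse_on_finite_set:
  assumes X: "right_module R X" and N: "right_module R N"
    and functional: "\<And>y. y \<in> carrier N \<Longrightarrow> \<exists>h\<in>rmod_hom R N (right_regular_module R).
      (\<forall>x\<in>carrier N. h y \<otimes> h x = h x) \<and> y \<ominus>\<^bsub>N\<^esub> h y \<odot>\<^bsub>N\<^esub> y \<in> singular_elements R N"
    and \<phi>: "\<phi> \<in> rmod_hom R X N"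
    and "finite T" and m: "\<And>t. t \<in> T \<Longrightarrow> m t \<in> carrier X"
  shows "\<exists>\<psi>\<in>rmod_hom R N X. (\<forall>x\<in>carrier N. \<psi> (\<phi> (\<psi> x)) = \<psi> x) \<and>
    (\<forall>t\<in>T. \<phi> (m t) \<ominus>\<^bsub>N\<^esub> \<phi> (\<psi> (\<phi> (m t))) \<in> singular_elements R N)"
  using \<open>finite T\<close> m
proof (induction T)
  case empty
  interpret X: right_module R X by (rule X)
  have "(\<lambda>x. \<zero>\<^bsub>X\<^esub>) \<in> rmod_hom R N X" by (rule rmod_homI) auto
  then show ?case by (rule bexI[rotated]) auto
next
  case (insert s T)
  interpret X: right_module R X by (rule X)
  interpret N: right_module R N by (rule N)
  let ?S = "right_regular_module R"
  note sing = N.submoduleD[OF submodule_singular_elements[OF N]]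
  obtain \<psi> where \<psi>: "\<psi> \<in> rmod_hom R N X" and quasi: "\<forall>x\<in>carrier N. \<psi> (\<phi> (\<psi> x)) = \<psi> x"
    and \<psi>T: "\<forall>t\<in>T. \<phi> (m t) \<ominus>\<^bsub>N\<^esub> \<phi> (\<psi> (\<phi> (m t))) \<in> singular_elements R N"
    using insert by auto
  note \<phi>D = rmod_homD[OF \<phi>] rmod_hom_diff[OF X N \<phi>]
    and \<psi>D = rmod_homD[OF \<psi>] rmod_hom_diff[OF N X \<psi>]
  have ms: "m s \<in> carrier X" using insert by simp
  define e where "e x = \<phi> (\<psi> x)" for x
  have e: "e \<in> rmod_hom R N N" unfolding e_def by (rule rmod_hom_comp[OF \<psi> \<phi>])
  note eD = rmod_homD[OF e] rmod_hom_diff[OF N N e]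
  have ee: "e (e x) = e x" and \<psi>e: "\<psi> (e x) = \<psi> x" if "x \<in> carrier N" for x
    using quasi that by (auto simp: e_def)
  define y where "y = \<phi> (m s)"
  define y' where "y' = y \<ominus>\<^bsub>N\<^esub> e y"
  have y: "y \<in> carrier N" using ms \<phi>D(1) by (simp add: y_def)
  then have y': "y' \<in> carrier N" "e y' = \<zero>\<^bsub>N\<^esub>"
    using eD ee by (auto simp: y'_def N.diff_eq_zero_iff)
  obtain h where h: "h \<in> rmod_hom R N ?S" and hy': "\<forall>x\<in>carrier N. h y' \<otimes> h x = h x"
    and hsing: "y' \<ominus>\<^bsub>N\<^esub> h y' \<odot>\<^bsub>N\<^esub> y' \<in> singular_elements R N"
    using functional[OF y'(1)] by blast
  define h' where "h' x = h (x \<ominus>\<^bsub>N\<^esub> e x)" for x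
  have h': "h' \<in> rmod_hom R N ?S"
    unfolding h'_def by (rule rmod_hom_comp[OF rmod_hom_sub[OF N rmod_hom_id e] h])
  note hD = functional_rules[OF N h] and h'D = functional_rules[OF N h']
  have h'e: "h' (e x) = \<zero>" if "x \<in> carrier N" for x
    using that eD(1) ee hD(5) by (simp add: h'_def N.minus_eq N.r_neg)
  have h'y': "h' y' = h y'" using y' by (simp add: h'_def)
  have h'y: "h' y = h y'" by (simp add: h'_def y'_def)
  define \<psi>' where "\<psi>' x = \<psi> (x \<ominus>\<^bsub>N\<^esub> h' x \<odot>\<^bsub>N\<^esub> y) \<oplus>\<^bsub>X\<^esub> h' x \<odot>\<^bsub>X\<^esub> m s" for x
  have smult_hom: "(\<lambda>a. a \<odot>\<^bsub>P\<^esub> p) \<in> rmod_hom R ?S P" if "right_module R P" "p \<in> carrier P"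
    for p and P :: "('a, 'z) module"
  proof -
    interpret P: right_module R P by (rule that)
    show ?thesis using that(2) by (intro rmod_homI) (auto simp: P.smult_l_distr P.smult_assoc)
  qed
  have \<psi>': "\<psi>' \<in> rmod_hom R N X"
    unfolding \<psi>'_def
    by (intro rmod_hom_add[OF X] rmod_hom_comp[OF _ \<psi>] rmod_hom_sub[OF N] rmod_hom_id
        rmod_hom_comp[OF h' smult_hom[OF N y]] rmod_hom_comp[OF h' smult_hom[OF X ms]])
  have \<phi>\<psi>': "\<phi> (\<psi>' x) = e x \<oplus>\<^bsub>N\<^esub> h' x \<odot>\<^bsub>N\<^esub> y'" if x: "x \<in> carrier N" for x
  proof -
    have a: "h' x \<in> carrier R" using h'D(1) x .
    have "\<phi> (\<psi>' x) = e (x \<ominus>\<^bsub>N\<^esub> h' x \<odot>\<^bsub>N\<^esub> y) \<oplus>\<^bsub>N\<^esub> h' x \<odot>\<^bsub>N\<^esub> y"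
      using x a ms y \<psi>D(1) by (simp add: \<psi>'_def \<phi>D e_def y_def)
    also have "\<dots> = e x \<ominus>\<^bsub>N\<^esub> h' x \<odot>\<^bsub>N\<^esub> e y \<oplus>\<^bsub>N\<^esub> h' x \<odot>\<^bsub>N\<^esub> y"
      using x a y by (simp add: eD)
    also have "\<dots> = e x \<oplus>\<^bsub>N\<^esub> h' x \<odot>\<^bsub>N\<^esub> y'"
      using x a y eD(1) by (simp add: y'_def N.smult_r_distr N.smult_r_minus N.minus_eq N.a_ac)
    finally show ?thesis .
  qed
  have "\<psi>' (\<phi> (\<psi>' x)) = \<psi>' x" if x: "x \<in> carrier N" for x
  proof -
    have a: "h' x \<in> carrier R" using h'D(1) x .
    define v where "v = \<phi> (\<psi>' x)"
    have v: "v = e x \<oplus>\<^bsub>N\<^esub> h' x \<odot>\<^bsub>N\<^esub> y'" by (simp add: v_def \<phi>\<psi>'[OF x])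
    have vN: "v \<in> carrier N" using x a y' eD(1) by (simp add: v)
    have "h' v = h y' \<otimes> h' x"
      using x a y' eD(1) h'e h'y' hD(1) by (simp add: v h'D)
    also have "\<dots> = h' x"
      using hy' x eD(1) by (simp add: h'_def)
    finally have h'v: "h' v = h' x" .
    have "v \<ominus>\<^bsub>N\<^esub> h' x \<odot>\<^bsub>N\<^esub> y = e (x \<ominus>\<^bsub>N\<^esub> h' x \<odot>\<^bsub>N\<^esub> y)"
    proof -
      have c: "e x \<in> carrier N" "h' x \<odot>\<^bsub>N\<^esub> y \<in> carrier N" "h' x \<odot>\<^bsub>N\<^esub> e y \<in> carrier N"
        using x a y eD(1) by auto
      have "v \<ominus>\<^bsub>N\<^esub> h' x \<odot>\<^bsub>N\<^esub> y
          = e x \<oplus>\<^bsub>N\<^esub> (h' x \<odot>\<^bsub>N\<^esub> y \<ominus>\<^bsub>N\<^esub> h' x \<odot>\<^bsub>N\<^esub> e y) \<ominus>\<^bsub>N\<^esub> h' x \<odot>\<^bsub>N\<^esub> y"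
        using x a y eD(1)
        by (simp add: v y'_def N.smult_r_distr N.smult_r_minus N.minus_eq)
      also have "\<dots> = e x \<ominus>\<^bsub>N\<^esub> h' x \<odot>\<^bsub>N\<^esub> e y" using c by algebra
      also have "\<dots> = e (x \<ominus>\<^bsub>N\<^esub> h' x \<odot>\<^bsub>N\<^esub> y)" using x a y by (simp add: eD)
      finally show ?thesis .
    qed
    then have "\<psi>' v = \<psi>' x" using h'v \<psi>e x a y by (simp add: \<psi>'_def)
    then show ?thesis by (simp add: v_def)
  qed
  moreover have "\<phi> (m t) \<ominus>\<^bsub>N\<^esub> \<phi> (\<psi>' (\<phi> (m t))) \<in> singular_elements R N" if t: "t \<in> insert s T" for t
  proof -
    define v where "v = \<phi> (m t)"
    have v: "v \<in> carrier N" using insert.prems t \<phi>D(1) by (simp add: v_def)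
    have c: "v \<in> carrier N" "e v \<in> carrier N" "h' v \<odot>\<^bsub>N\<^esub> y' \<in> carrier N"
      using v eD(1) h'D(1) y' by auto
    have red: "v \<ominus>\<^bsub>N\<^esub> \<phi> (\<psi>' v) = (v \<ominus>\<^bsub>N\<^esub> e v) \<ominus>\<^bsub>N\<^esub> h' v \<odot>\<^bsub>N\<^esub> y'"
      unfolding \<phi>\<psi>'[OF v] using c by algebra
    show ?thesis
    proof (cases "t = s")
      case True
      then have "v = y" by (simp add: v_def y_def)
      then show ?thesis using red hsing h'y by (simp add: v_def flip: y'_def)
    next
      case False
      then have sv: "v \<ominus>\<^bsub>N\<^esub> e v \<in> singular_elements R N"
        using \<psi>T t by (simp add: v_def e_def)
      then have "h' v \<in> singular_elements R ?S"
        unfolding h'_def by (rule rmod_hom_singular_elements[OF N right_regular_module h])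
      then have "h' v \<odot>\<^bsub>N\<^esub> y' \<in> singular_elements R N"
        by (rule rmod_hom_singular_elements[OF right_regular_module N smult_hom[OF N y'(1)]])
      moreover have "\<ominus>\<^bsub>N\<^esub> u \<in> singular_elements R N" if "u \<in> singular_elements R N" for u
        using sing(5)[of "\<ominus> \<one>" u] sing(3)[of u] that by (simp add: N.smult_l_minus)
      ultimately show ?thesis using red sv sing(4) by (simp add: v_def N.minus_eq)
    qed
  qed
  ultimately show ?case using \<psi>' by blast
qed

text \<open>
  The quasi-inverse \<open>\<psi>\<close> for the generators \<open>m\<^sub>t\<close> works: \<open>\<theta> = \<phi> - \<phi>\<psi>\<phi>\<close> has singular values on the
  \<open>m\<^sub>t\<close>.  Given \<open>x \<noteq> 0\<close>, a scalar \<open>r\<close> with \<open>xr \<noteq> 0\<close> is found such that every coordinate \<open>f\<^sub>t(xr)\<close>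
  annihilates \<open>\<theta>(m\<^sub>t)\<close>; then \<open>\<theta>(xr) = 0\<close>.
\<close>

lemma regular_up_to_essential_kernel_if_finite_dual_basis:
  assumes reg: "regular_modulo_singular R" and M: "right_module R M"
    and dual: "finite_dual_basis R M T m f"
  shows "regular_up_to_essential_kernel R M"
  unfolding regular_up_to_essential_kernel_def
proof
  interpret M: right_module R M by (rule M)
  fix \<phi> assume \<phi>: "\<phi> \<in> rmod_hom R M M"
  have T: "finite T" and m: "\<And>t. t \<in> T \<Longrightarrow> m t \<in> carrier M"
    and f: "\<And>t. t \<in> T \<Longrightarrow> f t \<in> rmod_hom R M (right_regular_module R)"
    and span: "\<And>x N. x \<in> carrier M \<Longrightarrow> submodule N R M \<Longrightarrow> (\<forall>t\<in>T. f t x \<odot>\<^bsub>M\<^esub> m t \<in> N) \<Longrightarrow> x \<in> N"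
    using dual by (auto simp: finite_dual_basis_def)
  obtain \<psi> where \<psi>: "\<psi> \<in> rmod_hom R M M" and quasi: "\<forall>x\<in>carrier M. \<psi> (\<phi> (\<psi> x)) = \<psi> x"
    and sing: "\<forall>t\<in>T. \<phi> (m t) \<ominus>\<^bsub>M\<^esub> \<phi> (\<psi> (\<phi> (m t))) \<in> singular_elements R M"
    using quasi_inverse_on_finite_set[where m = m, OF M M functional_quasi_inverse[OF reg M dual] \<phi> T m] by blast
  define \<theta> where "\<theta> x = \<phi> x \<ominus>\<^bsub>M\<^esub> \<phi> (\<psi> (\<phi> x))" for x
  have \<phi>\<psi>\<phi>: "(\<lambda>x. \<phi> (\<psi> (\<phi> x))) \<in> rmod_hom R M M"
    using rmod_hom_comp[OF \<phi> rmod_hom_comp[OF \<psi> \<phi>]] .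
  have \<theta>: "\<theta> \<in> rmod_hom R M M" unfolding \<theta>_def by (rule rmod_hom_sub[OF M \<phi> \<phi>\<psi>\<phi>])
  note \<theta>D = rmod_homD[OF \<theta>]
  have ess: "\<exists>r\<in>carrier R. r \<odot>\<^bsub>M\<^esub> x \<noteq> \<zero>\<^bsub>M\<^esub> \<and> (\<forall>t\<in>T'. f t (r \<odot>\<^bsub>M\<^esub> x) \<odot>\<^bsub>M\<^esub> \<theta> (m t) = \<zero>\<^bsub>M\<^esub>)"
    if "finite T'" "T' \<subseteq> T" and x: "x \<in> carrier M" "x \<noteq> \<zero>\<^bsub>M\<^esub>" for x T'
    using that(1,2)
  proof (induction T')
    case empty
    then show ?case using x by (intro bexI[of _ \<one>]) auto
  next
    case (insert s T')
    then obtain r where r: "r \<in> carrier R" "r \<odot>\<^bsub>M\<^esub> x \<noteq> \<zero>\<^bsub>M\<^esub>"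
      "\<forall>t\<in>T'. f t (r \<odot>\<^bsub>M\<^esub> x) \<odot>\<^bsub>M\<^esub> \<theta> (m t) = \<zero>\<^bsub>M\<^esub>" by auto
    have sT: "s \<in> T" using insert by simp
    define a where "a = f s (r \<odot>\<^bsub>M\<^esub> x)"
    have rx: "r \<odot>\<^bsub>M\<^esub> x \<in> carrier M" using r x by simp
    have a: "a \<in> carrier R" using functional_rules(1)[OF M f[OF sT] rx] by (simp add: a_def)
    have \<theta>m: "\<theta> (m t) \<in> carrier M" if "t \<in> T" for t using that m \<theta>D(1) by simp
    show ?case
    proof (cases "a = \<zero>")
      case True
      then show ?thesis using r \<theta>m[OF sT] by (auto simp: a_def intro!: bexI[of _ r])
    next
      case False
      \<comment> \<open>A multiple of \<open>xr\<close> cannot vanish as long as its coordinate \<open>f\<^sub>s\<close> does not.\<close>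
      have "\<theta> (m s) \<in> singular_elements R M" using sing sT by (simp add: \<theta>_def)
      from singular_elementsD(2)[OF this a False]
      obtain q where q: "q \<in> carrier R" "a \<otimes> q \<noteq> \<zero>" "(a \<otimes> q) \<odot>\<^bsub>M\<^esub> \<theta> (m s) = \<zero>\<^bsub>M\<^esub>"
        by blast
      have f_rq: "f t ((r \<otimes> q) \<odot>\<^bsub>M\<^esub> x) = f t (r \<odot>\<^bsub>M\<^esub> x) \<otimes> q" if "t \<in> T" for t
        using functional_rules(4)[OF M f[OF that] q(1) rx] r(1) q(1) x(1) by (simp add: M.smult_assoc)
      have "(r \<otimes> q) \<odot>\<^bsub>M\<^esub> x \<noteq> \<zero>\<^bsub>M\<^esub>"
        using f_rq[OF sT] functional_rules(5)[OF M f[OF sT]] q(2) by (auto simp: a_def)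
      moreover have "f t ((r \<otimes> q) \<odot>\<^bsub>M\<^esub> x) \<odot>\<^bsub>M\<^esub> \<theta> (m t) = \<zero>\<^bsub>M\<^esub>" if t: "t \<in> insert s T'" for t
      proof (cases "t = s")
        case True
        then show ?thesis using f_rq[OF sT] q(3) by (simp add: a_def)
      next
        case False
        then have "t \<in> T" "t \<in> T'" using t insert by auto
        moreover have "f t (r \<odot>\<^bsub>M\<^esub> x) \<in> carrier R"
          using functional_rules(1)[OF M f[OF \<open>t \<in> T\<close>] rx] .
        ultimately show ?thesis using f_rq r(3) q(1) \<theta>m by (simp add: M.smult_assoc)
      qed
      ultimately show ?thesis using r(1) q(1) by (intro bexI[of _ "r \<otimes> q"]) auto
    qed
  qed
  have "\<exists>r\<in>carrier R. r \<odot>\<^bsub>M\<^esub> x \<noteq> \<zero>\<^bsub>M\<^esub> \<and> \<phi> (\<psi> (\<phi> (r \<odot>\<^bsub>M\<^esub> x))) = \<phi> (r \<odot>\<^bsub>M\<^esub> x)"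
    if x: "x \<in> carrier M" "x \<noteq> \<zero>\<^bsub>M\<^esub>" for x
  proof -
    obtain r where r: "r \<in> carrier R" "r \<odot>\<^bsub>M\<^esub> x \<noteq> \<zero>\<^bsub>M\<^esub>"
      "\<forall>t\<in>T. f t (r \<odot>\<^bsub>M\<^esub> x) \<odot>\<^bsub>M\<^esub> \<theta> (m t) = \<zero>\<^bsub>M\<^esub>" using ess[OF T subset_refl x] by blast
    define y where "y = r \<odot>\<^bsub>M\<^esub> x"
    have y: "y \<in> carrier M" using r x by (simp add: y_def)
    have "submodule {z \<in> carrier M. \<phi> (\<psi> (\<phi> z)) = \<phi> z} R M"
      by (rule submodule_equalizer[OF M M \<phi>\<psi>\<phi> \<phi>])
    moreover have "f t y \<odot>\<^bsub>M\<^esub> m t \<in> {z \<in> carrier M. \<phi> (\<psi> (\<phi> z)) = \<phi> z}" if t: "t \<in> T" for t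
    proof -
      have c: "f t y \<in> carrier R" using functional_rules(1)[OF M f[OF t] y] .
      then have "\<theta> (f t y \<odot>\<^bsub>M\<^esub> m t) = \<zero>\<^bsub>M\<^esub>" using \<theta>D(3) m t r(3) by (simp add: y_def)
      moreover have mem: "f t y \<odot>\<^bsub>M\<^esub> m t \<in> carrier M" using c m t by simp
      ultimately have "\<phi> (f t y \<odot>\<^bsub>M\<^esub> m t) = \<phi> (\<psi> (\<phi> (f t y \<odot>\<^bsub>M\<^esub> m t)))"
        using rmod_homD(1)[OF \<phi>] rmod_homD(1)[OF \<psi>] unfolding \<theta>_def
        by (subst (asm) M.diff_eq_zero_iff) auto
      then show ?thesis using mem by simp
    qed
    ultimately have "y \<in> {z \<in> carrier M. \<phi> (\<psi> (\<phi> z)) = \<phi> z}" using span[OF y] by blast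
    then show ?thesis using r by (auto simp: y_def)
  qed
  then show "\<exists>\<psi>\<in>rmod_hom R M M. (\<forall>x\<in>carrier M. \<psi> (\<phi> (\<psi> x)) = \<psi> x) \<and>
      (\<forall>x\<in>carrier M. x \<noteq> \<zero>\<^bsub>M\<^esub> \<longrightarrow>
        (\<exists>r\<in>carrier R. r \<odot>\<^bsub>M\<^esub> x \<noteq> \<zero>\<^bsub>M\<^esub> \<and> \<phi> (\<psi> (\<phi> (r \<odot>\<^bsub>M\<^esub> x))) = \<phi> (r \<odot>\<^bsub>M\<^esub> x)))"
    using quasi by (intro bexI[OF _ \<psi>]) auto
qed

end

section \<open>Free and projective modules\<close>

lemma free_right_module_simps:
  "carrier (free_right_module R I) =
    {f. range f \<subseteq> carrier R \<and> {x. f x \<noteq> \<zero>\<^bsub>R\<^esub>} \<subseteq> I \<and> finite {x. f x \<noteq> \<zero>\<^bsub>R\<^esub>}}"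
  "\<zero>\<^bsub>free_right_module R I\<^esub> = (\<lambda>_. \<zero>\<^bsub>R\<^esub>)"
  "f \<oplus>\<^bsub>free_right_module R I\<^esub> g = (\<lambda>x. f x \<oplus>\<^bsub>R\<^esub> g x)"
  "a \<odot>\<^bsub>free_right_module R I\<^esub> f = (\<lambda>x. f x \<otimes>\<^bsub>R\<^esub> a)"
  by (simp_all add: free_right_module_def)

lemma free_right_module_memI:
  assumes "\<And>x. f x \<in> carrier R" "{x. f x \<noteq> \<zero>\<^bsub>R\<^esub>} \<subseteq> S" "finite S" "S \<subseteq> I"
  shows "f \<in> carrier (free_right_module R I)"
  using assms finite_subset unfolding free_right_module_simps by blast

lemma free_right_module_memD:
  assumes "f \<in> carrier (free_right_module R I)"
  shows "\<And>x. f x \<in> carrier R" "finite {x. f x \<noteq> \<zero>\<^bsub>R\<^esub>}" "{x. f x \<noteq> \<zero>\<^bsub>R\<^esub>} \<subseteq> I"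
  using assms unfolding free_right_module_simps by auto

definition single :: "('a, 'b) ring_scheme \<Rightarrow> 'x \<Rightarrow> 'a \<Rightarrow> 'x \<Rightarrow> 'a"
  where "single R i a = (\<lambda>j. if j = i then a else \<zero>\<^bsub>R\<^esub>)"

context ring
begin

lemma free_right_module_right_module: "right_module R (free_right_module R I)"
proof -
  let ?F = "free_right_module R I"
  note simps = free_right_module_simps
  show ?thesis
  proof (intro right_module.intro abelian_groupI right_module_axioms.intro)
    show "ring R" ..
  next
    fix v w assume vw: "v \<in> carrier ?F" "w \<in> carrier ?F"
    note vD = free_right_module_memD[OF vw(1)] and wD = free_right_module_memD[OF vw(2)]
    show "v \<oplus>\<^bsub>?F\<^esub> w \<in> carrier ?F"
      unfolding simps(3)
      by (rule free_right_module_memI[where S = "{x. v x \<noteq> \<zero>} \<union> {x. w x \<noteq> \<zero>}"])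
        (use vD wD in auto)
    show "v \<oplus>\<^bsub>?F\<^esub> w = w \<oplus>\<^bsub>?F\<^esub> v"
      using vD(1) wD(1) by (simp add: simps a_comm)
  next
    fix v assume v: "v \<in> carrier ?F"
    note vD = free_right_module_memD[OF v]
    have "(\<lambda>x. \<ominus> v x) \<in> carrier ?F"
      by (rule free_right_module_memI[where S = "{x. v x \<noteq> \<zero>}"]) (use vD in auto)
    moreover have "(\<lambda>x. \<ominus> v x) \<oplus>\<^bsub>?F\<^esub> v = \<zero>\<^bsub>?F\<^esub>"
      using vD(1) by (simp add: simps l_neg)
    ultimately show "\<exists>w\<in>carrier ?F. w \<oplus>\<^bsub>?F\<^esub> v = \<zero>\<^bsub>?F\<^esub>" by blast
  next
    fix a v assume a: "a \<in> carrier R" and v: "v \<in> carrier ?F"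
    note vD = free_right_module_memD[OF v]
    show "a \<odot>\<^bsub>?F\<^esub> v \<in> carrier ?F"
      unfolding simps(4)
      by (rule free_right_module_memI[where S = "{x. v x \<noteq> \<zero>}"]) (use a vD in auto)
  qed (auto simp: simps image_subset_iff a_assoc l_distr r_distr m_assoc)
qed

lemma single_carrier:
  "a \<in> carrier R \<Longrightarrow> i \<in> I \<Longrightarrow> single R i a \<in> carrier (free_right_module R I)"
  by (rule free_right_module_memI[where S = "{i}"]) (auto simp: single_def)

text \<open>
  A family of finite support is the sum of its components; they are split off one at a time.
\<close>

lemma free_right_module_span:
  assumes "finite T" and "T \<subseteq> I" and K: "submodule K R (free_right_module R I)"
    and "v \<in> carrier (free_right_module R I)" and "\<And>i. i \<notin> T \<Longrightarrow> v i = \<zero>"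
    and "\<And>i. i \<in> T \<Longrightarrow> single R i (v i) \<in> K"
  shows "v \<in> K"
  using assms(1,2,4-6)
proof (induction T arbitrary: v)
  case empty
  then have "v = \<zero>\<^bsub>free_right_module R I\<^esub>" by (auto simp: free_right_module_simps)
  then show ?case
    using right_module.submoduleD(2)[OF free_right_module_right_module K] by simp
next
  case (insert s T)
  let ?F = "free_right_module R I"
  interpret F: right_module R ?F by (rule free_right_module_right_module)
  note v = insert.prems(2)
  have vR: "v i \<in> carrier R" for i using v by (auto simp: free_right_module_simps image_subset_iff)
  define w where "w = v(s := \<zero>)"
  have w: "w \<in> carrier ?F"
    by (rule free_right_module_memI[where S = "{x. v x \<noteq> \<zero>}"])
      (use free_right_module_memD[OF v] in \<open>auto simp: w_def\<close>)
  have "w \<in> K"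
  proof (rule insert.IH)
    show "single R i (w i) \<in> K" if "i \<in> T" for i
      using insert.prems(4)[of i] insert.hyps that by (auto simp: w_def)
    show "w i = \<zero>" if "i \<notin> T" for i
      using insert.prems(3)[of i] that by (auto simp: w_def)
  qed (use insert.prems w in auto)
  then have "w \<oplus>\<^bsub>?F\<^esub> single R s (v s) \<in> K"
    using F.submoduleD(4)[OF K] insert.prems(4)[of s] by simp
  moreover have "w \<oplus>\<^bsub>?F\<^esub> single R s (v s) = v"
    using vR by (auto simp: free_right_module_simps w_def single_def)
  ultimately show ?case by simp
qed

text \<open>
  Let \<open>g\<close> be an isomorphism of \<open>M\<close> to a summand of a free module, and let \<open>q\<close> be the projection to the
  summand followed by the inverse of \<open>g\<close>, so that \<open>q(g(x)) = x\<close>.  The coordinates of \<open>g\<close> and the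
  images under \<open>q\<close> of the unit vectors form a dual basis, and the finitely many generators of \<open>M\<close>
  only involve a finite set \<open>T\<close> of coordinates.
\<close>

lemma finite_dual_basis_if_projective:
  fixes M :: "('a, 'm) module"
  assumes M: "right_module R M" and fg: "finitely_generated R M" and proj: "projective R M"
  shows "\<exists>(T :: 'm set) m f. finite_dual_basis R M T m f"
proof -
  interpret M: right_module R M by (rule M)
  obtain I :: "'m set" and D where D: "direct_summand D R (free_right_module R I)"
    and iso: "rmod_iso R M ((free_right_module R I)\<lparr>carrier := D\<rparr>)"
    using proj unfolding projective_def by blast
  define F where "F = free_right_module R I"
  have F: "right_module R F" unfolding F_def by (rule free_right_module_right_module)
  interpret F: right_module R F by (rule F)
  have Fcar: "v i \<in> carrier R" "finite {i. v i \<noteq> \<zero>}" "v i \<noteq> \<zero> \<Longrightarrow> i \<in> I"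
    if "v \<in> carrier F" for v i
    using that by (auto simp: F_def free_right_module_simps image_subset_iff)
  have Fops: "(v \<oplus>\<^bsub>F\<^esub> w) i = v i \<oplus> w i" "(a \<odot>\<^bsub>F\<^esub> v) i = v i \<otimes> a" "\<zero>\<^bsub>F\<^esub> i = \<zero>" for v w a i
    by (simp_all add: F_def free_right_module_simps)
  obtain p where DF: "D \<subseteq> carrier F" and p: "p \<in> rmod_hom R F F"
    and pD: "\<forall>x\<in>carrier F. p x \<in> D" and px: "\<forall>x\<in>D. p x = x"
    using D[folded F_def] unfolding direct_summand_iff_projection[OF F] by blast
  obtain g where g: "g \<in> rmod_hom R M (F\<lparr>carrier := D\<rparr>)" and bij: "bij_betw g (carrier M) D"
    using iso unfolding rmod_iso_def F_def by auto
  have gD: "g x \<in> D" if "x \<in> carrier M" for x using rmod_homD(1)[OF g] that by simp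
  have gF: "g \<in> rmod_hom R M F"
    using rmod_homD[OF g] DF by (intro rmod_homI) auto
  note gH = rmod_homD[OF gF]
  define q where "q v = inv_into (carrier M) g (p v)" for v
  have pFD: "p \<in> rmod_hom R F (F\<lparr>carrier := D\<rparr>)"
    using rmod_homD[OF p] pD by (intro rmod_homI) auto
  have "inv_into (carrier M) g \<in> rmod_hom R (F\<lparr>carrier := D\<rparr>) M"
    using rmod_hom_inv_into[OF M g] bij by simp
  from rmod_hom_comp[OF pFD this] have q: "q \<in> rmod_hom R F M" unfolding q_def .
  have qg: "q (g x) = x" if "x \<in> carrier M" for x
    using that px gD bij by (simp add: q_def bij_betw_def)
  obtain S where S: "finite S" "S \<subseteq> carrier M"
    and gen: "\<forall>N. submodule N R M \<and> S \<subseteq> N \<longrightarrow> N = carrier M"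
    using fg unfolding finitely_generated_def by (elim exE conjE) (rule that)
  define T where "T = (\<Union>s\<in>S. {i. g s i \<noteq> \<zero>})"
  have T: "finite T" "T \<subseteq> I"
    using S Fcar(2,3)[OF gH(1)] by (auto simp: T_def)
  have supp: "g x i = \<zero>" if "x \<in> carrier M" "i \<notin> T" for x i
  proof -
    have "submodule {x \<in> carrier M. \<forall>i. i \<notin> T \<longrightarrow> g x i = \<zero>} R M"
      unfolding M.submodule_iff
      using gH rmod_hom_zero[OF M F gF] by (auto simp: Fops)
    moreover have "S \<subseteq> {x \<in> carrier M. \<forall>i. i \<notin> T \<longrightarrow> g x i = \<zero>}"
      using S by (auto simp: T_def)
    ultimately show ?thesis using gen that by blast
  qed
  have "finite_dual_basis R M T (\<lambda>t. q (single R t \<one>)) (\<lambda>t x. g x t)"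
    unfolding finite_dual_basis_def
  proof (intro conjI ballI allI impI)
    show "finite T" by (rule T)
  next
    fix t assume "t \<in> T"
    then show "q (single R t \<one>) \<in> carrier M"
      using rmod_homD(1)[OF q] single_carrier[of \<one> t I] T(2) by (auto simp: F_def)
    show "(\<lambda>x. g x t) \<in> rmod_hom R M (right_regular_module R)"
      using gH Fcar by (intro rmod_homI) (auto simp: Fops)
  next
    fix x N assume x: "x \<in> carrier M" and N: "submodule N R M"
      and mem: "\<forall>t\<in>T. g x t \<odot>\<^bsub>M\<^esub> q (single R t \<one>) \<in> N"
    define K where "K = {v \<in> carrier F. q v \<in> N}"
    have K: "submodule K R F" unfolding K_def by (rule submodule_vimage[OF F M q N])
    have "g x \<in> K"
    proof (rule free_right_module_span[OF T K[unfolded F_def]])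
      show "g x \<in> carrier (free_right_module R I)" using gH(1)[OF x] by (simp add: F_def)
      show "g x i = \<zero>" if "i \<notin> T" for i using supp[OF x that] .
      fix i assume i: "i \<in> T"
      have c: "g x i \<in> carrier R" using Fcar gH(1)[OF x] by simp
      have u: "single R i \<one> \<in> carrier F" using single_carrier[of \<one> i I] i T by (auto simp: F_def)
      have "single R i (g x i) = g x i \<odot>\<^bsub>F\<^esub> single R i \<one>"
        using c by (auto simp: Fops single_def)
      then show "single R i (g x i) \<in> K"
        using c u mem i rmod_homD(3)[OF q c u] by (simp add: K_def)
    qed
    then show "x \<in> N" using qg[OF x] by (simp add: K_def)
  qed
  then show ?thesis by blast
qed

lemma rank_one_free_coordinate:
  assumes "v \<in> carrier (free_right_module R {i})"
  shows "v i \<in> carrier R" "v = v i \<odot>\<^bsub>free_right_module R {i}\<^esub> single R i \<one>"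
  using free_right_module_memD[OF assms]
  by (auto simp: free_right_module_simps single_def fun_eq_iff)

lemma finitely_generated_rank_one_free: "finitely_generated R (free_right_module R {i})"
  unfolding finitely_generated_def
proof (intro exI conjI allI impI)
  let ?F = "free_right_module R {i}"
  interpret F: right_module R ?F by (rule free_right_module_right_module)
  show "{single R i \<one>} \<subseteq> carrier ?F" by (simp add: single_carrier)
  fix N assume N: "submodule N R ?F \<and> {single R i \<one>} \<subseteq> N"
  then have "v \<in> N" if "v \<in> carrier ?F" for v
    using rank_one_free_coordinate[OF that] F.submoduleD(5)[of N "v i" "single R i \<one>"]
    by simp
  then show "N = carrier ?F" using N F.submoduleD(1) by blast
qed simp

text \<open>
  The index set in the definition of \<open>projective\<close> has to consist of elements of the type of the
  module, here families; hence the passage to a one-element index set \<open>{j}\<close> with an arbitrary \<open>j\<close>.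
\<close>

lemma projective_rank_one_free: "projective R (free_right_module R {i :: 'x})"
  unfolding projective_def
proof (intro exI conjI)
  let ?F = "free_right_module R {i}"
  define j :: "'x \<Rightarrow> 'a" where "j = undefined"
  let ?G = "free_right_module R {j}"
  have G: "right_module R ?G" by (rule free_right_module_right_module)
  show "direct_summand (carrier ?G) R ?G"
    unfolding direct_summand_iff_projection[OF G]
    by (intro conjI bexI[OF _ rmod_hom_id]) auto
  have to_G: "single R j (v i) \<in> carrier ?G" if "v \<in> carrier ?F" for v
    using rank_one_free_coordinate(1)[OF that] by (simp add: single_carrier)
  have to_F: "single R i (v j) \<in> carrier ?F" if "v \<in> carrier ?G" for v
    using rank_one_free_coordinate(1)[OF that] by (simp add: single_carrier)
  have single_coord: "single R k (v k) = v" if "v \<in> carrier (free_right_module R {k})"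
    for v and k :: 'z
  proof -
    have "v l = \<zero>" if "l \<noteq> k" for l
      using free_right_module_memD(3)[OF \<open>v \<in> _\<close>] that by blast
    then show ?thesis by (auto simp: single_def fun_eq_iff)
  qed
  have "(\<lambda>v. single R j (v i)) \<in> rmod_hom R ?F ?G"
    by (intro rmod_homI to_G) (auto simp: free_right_module_simps single_def)
  moreover have "bij_betw (\<lambda>v. single R j (v i)) (carrier ?F) (carrier ?G)"
  proof (rule bij_betwI[where g = "\<lambda>v. single R i (v j)"])
    show "single R i (single R j (v i) j) = v" if "v \<in> carrier ?F" for v
      using single_coord[OF that] by (simp add: single_def)
    show "single R j (single R i (v j) i) = v" if "v \<in> carrier ?G" for v
      using single_coord[OF that] by (simp add: single_def)
  qed (use to_F to_G in auto)
  ultimately show "rmod_iso R ?F (?G\<lparr>carrier := carrier ?G\<rparr>)"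
    unfolding rmod_iso_def by auto
qed

text \<open>
  Endomorphisms of the free module of rank one are left multiplications by ring elements:
  the multiplication by \<open>a\<close> has a quasi-inverse, which is the multiplication by some \<open>b\<close>.
\<close>

lemma regular_modulo_singular_if_rank_one_free:
  assumes reg: "regular_up_to_essential_kernel R (free_right_module R {i})"
  shows "regular_modulo_singular R"
  unfolding regular_modulo_singular_def
proof
  let ?F = "free_right_module R {i}"
  define u where "u = single R i \<one>"
  have u: "u \<in> carrier ?F" unfolding u_def by (simp add: single_carrier)
  fix a assume a: "a \<in> carrier R"
  define \<phi> where "\<phi> v = (\<lambda>k. a \<otimes> v k)" for v :: "'c \<Rightarrow> 'a"
  have \<phi>hom: "\<phi> \<in> rmod_hom R ?F ?F"
  proof (rule rmod_homI)
    fix v assume v: "v \<in> carrier ?F"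
    show "\<phi> v \<in> carrier ?F"
      unfolding \<phi>_def
      by (rule free_right_module_memI[where S = "{x. v x \<noteq> \<zero>}"])
        (use a free_right_module_memD[OF v] in auto)
  qed (use a in \<open>auto simp: free_right_module_simps \<phi>_def r_distr m_assoc image_subset_iff\<close>)
  from bspec[OF reg[unfolded regular_up_to_essential_kernel_def] \<phi>hom]
  obtain \<psi> where \<psi>: "\<psi> \<in> rmod_hom R ?F ?F"
    and quasi: "\<forall>v\<in>carrier ?F. \<psi> (\<phi> (\<psi> v)) = \<psi> v"
    and ess: "\<forall>v\<in>carrier ?F. v \<noteq> \<zero>\<^bsub>?F\<^esub> \<longrightarrow>
      (\<exists>r\<in>carrier R. r \<odot>\<^bsub>?F\<^esub> v \<noteq> \<zero>\<^bsub>?F\<^esub> \<and> \<phi> (\<psi> (\<phi> (r \<odot>\<^bsub>?F\<^esub> v))) = \<phi> (r \<odot>\<^bsub>?F\<^esub> v))"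
    by (elim bexE conjE) (rule that)
  interpret F: right_module R ?F by (rule free_right_module_right_module)
  have \<phi>: "\<phi> v \<in> carrier ?F" if "v \<in> carrier ?F" for v
    using rmod_homD(1)[OF \<phi>hom that] .
  define b where "b = \<psi> u i"
  have b: "b \<in> carrier R" using rank_one_free_coordinate(1) rmod_homD(1)[OF \<psi> u] by (simp add: b_def)
  have \<phi>i: "\<phi> v i = a \<otimes> v i" for v by (simp add: \<phi>_def)
  have \<psi>i: "\<psi> v i = b \<otimes> v i" if v: "v \<in> carrier ?F" for v
  proof -
    have "\<psi> v = \<psi> (v i \<odot>\<^bsub>?F\<^esub> u)"
      using rank_one_free_coordinate(2)[OF v] by (simp add: u_def)
    also have "\<dots> = v i \<odot>\<^bsub>?F\<^esub> \<psi> u"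
      using rmod_homD(3)[OF \<psi> _ u] rank_one_free_coordinate(1)[OF v] by simp
    finally show ?thesis by (simp add: free_right_module_simps b_def)
  qed
  have \<psi>u: "\<psi> u \<in> carrier ?F" using rmod_homD(1)[OF \<psi> u] .
  have "\<psi> (\<phi> (\<psi> u)) i = b" using quasi u by (simp add: b_def)
  then have "b \<otimes> a \<otimes> b = b"
    using a b \<psi>i[OF \<phi>[OF \<psi>u]] by (simp add: \<phi>i m_assoc flip: b_def)
  moreover have "a \<ominus> a \<otimes> b \<otimes> a \<in> right_singular_ideal R"
    unfolding right_singular_ideal_iff
  proof (intro conjI ballI impI)
    show "a \<ominus> a \<otimes> b \<otimes> a \<in> carrier R" using a b by simp
    fix c assume c: "c \<in> carrier R" "c \<noteq> \<zero>"
    define v where "v = single R i c"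
    have v: "v \<in> carrier ?F" "v i = c"
      using c single_carrier[of c i "{i}"] by (simp_all add: v_def) (simp add: single_def)
    then have "v \<noteq> \<zero>\<^bsub>?F\<^esub>" using c by (auto simp: free_right_module_simps)
    then obtain r where r: "r \<in> carrier R" "r \<odot>\<^bsub>?F\<^esub> v \<noteq> \<zero>\<^bsub>?F\<^esub>"
      "\<phi> (\<psi> (\<phi> (r \<odot>\<^bsub>?F\<^esub> v))) = \<phi> (r \<odot>\<^bsub>?F\<^esub> v)" using ess v by blast
    define w where "w = r \<odot>\<^bsub>?F\<^esub> v"
    have w: "w \<in> carrier ?F" "w i = c \<otimes> r"
      using r v by (auto simp: w_def) (simp add: free_right_module_simps v)
    have "c \<otimes> r \<noteq> \<zero>"
    proof
      assume "c \<otimes> r = \<zero>"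
      then have "w = \<zero>\<^bsub>?F\<^esub>"
        using rank_one_free_coordinate(2)[OF w(1)] w(2) F.smult_l_null[OF u] by (simp add: u_def)
      then show False using r by (simp add: w_def)
    qed
    moreover have "a \<otimes> (b \<otimes> (a \<otimes> (c \<otimes> r))) = a \<otimes> (c \<otimes> r)"
      using arg_cong[OF r(3), of "\<lambda>f. f i"] \<psi>i[OF \<phi>[OF w(1)]] w(2) by (simp add: \<phi>i flip: w_def)
    then have "(a \<ominus> a \<otimes> b \<otimes> a) \<otimes> (c \<otimes> r) = \<zero>"
      using a b c r(1) by (simp add: minus_eq l_distr l_minus m_assoc r_neg)
    ultimately show "\<exists>r\<in>carrier R. c \<otimes> r \<noteq> \<zero> \<and> (a \<ominus> a \<otimes> b \<otimes> a) \<otimes> (c \<otimes> r) = \<zero>"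
      using r(1) by blast
  qed
  ultimately show "\<exists>b\<in>carrier R. b \<otimes> a \<otimes> b = b \<and> a \<ominus> a \<otimes> b \<otimes> a \<in> right_singular_ideal R"
    using b by blast
qed

lemma regular_up_to_essential_kernel_if_semiregular:
  fixes M :: "('a, 'm) module"
  assumes semi: "semiregular R \<and> jacobson_radical R = right_singular_ideal R"
    and M: "right_module R M \<and> finitely_generated R M \<and> projective R M"
  shows "regular_up_to_essential_kernel R M"
proof -
  obtain T :: "'m set" and m f where "finite_dual_basis R M T m f"
    using finite_dual_basis_if_projective M by blast
  then show ?thesis
    using regular_up_to_essential_kernel_if_finite_dual_basis
      regular_modulo_singular_if_semiregular semi M by blast
qed

end

theorem theorem3p5:
  fixes R :: "('a, 'b) ring_scheme"
  assumes "ring R" and "\<one>\<^bsub>R\<^esub> \<noteq> \<zero>\<^bsub>R\<^esub>"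
  shows
    "(semiregular R \<and> jacobson_radical R = right_singular_ideal R \<longleftrightarrow>
        (\<forall>M :: ('a, nat \<Rightarrow> 'a) module.
           right_module R M \<and> finitely_generated R M \<and> projective R M \<longrightarrow>
           CS_Rickart R M \<and> C2_module R M)) \<and>
     (semiregular R \<and> jacobson_radical R = right_singular_ideal R \<longrightarrow>
        (\<forall>M :: ('a, 'm) module.
           right_module R M \<and> finitely_generated R M \<and> projective R M \<longrightarrow>
           CS_Rickart R M \<and> C2_module R M))"
proof -
  interpret ring R by fact
  have "semiregular R \<and> jacobson_radical R = right_singular_ideal R"
    if modules: "\<forall>M :: ('a, nat \<Rightarrow> 'a) module.
      right_module R M \<and> finitely_generated R M \<and> projective R M \<longrightarrow>
      CS_Rickart R M \<and> C2_module R M"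
  proof -
    let ?F = "free_right_module R {0::nat}"
    have F: "right_module R ?F" by (rule free_right_module_right_module)
    have "CS_Rickart R ?F \<and> C2_module R ?F"
      using F finitely_generated_rank_one_free projective_rank_one_free
      by (intro modules[rule_format] conjI)
    then have "regular_up_to_essential_kernel R ?F"
      using regular_up_to_essential_kernel_if_CS_Rickart_C2[OF F] by blast
    then have "regular_modulo_singular R" by (rule regular_modulo_singular_if_rank_one_free)
    then show ?thesis
      using semiregular_if_regular_modulo_singular jacobson_radical_eq_right_singular_ideal by blast
  qed
  then show ?thesis
    by (intro conjI iffI impI allI CS_Rickart_if_regular_up_to_essential_kernel
        C2_module_if_regular_up_to_essential_kernel
        regular_up_to_essential_kernel_if_semiregular) simp_all
qed

end
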